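(* Let $\lambda\colon\mathcal{B}((0,1))\to[0,\infty]$ be the Lebesgue-Borel measure on $(0,1)$, let $(H,\|\cdot\|_H,\langle\cdot,\cdot\rangle_H)=(L^2(\lambda;\mathbb{R}),\|\cdot\|_{L^2(\lambda;\mathbb{R})},\langle\cdot,\cdot\rangle_{L^2(\lambda;\mathbb{R})})$, let $e_n\in H$, $n\in\mathbb{Z}$, satisfy for all $n\in\mathbb{N}$ that $e_0(\cdot)=1$, $e_n(\cdot)=\sqrt{2}\cos(2n\pi(\cdot))$, and $e_{-n}(\cdot)=\sqrt{2}\sin(2n\pi(\cdot))$, let $A\colon D(A)\subseteq H\to H$ be the linear operator which satisfies $D(A)=\{v\in H\colon\sum_{n\in\mathbb{Z}}n^4|\langle e_n,v\rangle_H|^2<\infty\}$ and, for all $v\in D(A)$, $Av=\sum_{n\in\mathbb{Z}}-4\pi^2n^2\langle e_n,v\rangle_He_n$, let $T,\eta\in(0,\infty)$, let $(H_r,\|\cdot\|_{H_r},\langle\cdot,\cdot\rangle_{H_r})$, $r\in\mathbb{R}$, be a family of interpolation spaces associated to $\eta-A$, let $P_N\in L(H_{-1},H_1)$, $N\in\mathbb{N}$, be the linear operators which satisfy for all $N\in\mathbb{N}$, $v\in H$ that $P_N(v)=\sum_{n=-N}^{N}\langle e_n,v\rangle_He_n$, let $(\Omega,\mathcal{F},\mathbb{P})$ be a probability space, let $q\in\{2,3,\dots\}$, $a_0,a_1,\dots,a_{q-1}\in\mathbb{R}$, $a_q\in\mathbb{R}\setminus\{0\}$, $\chi\in(1/4,\infty)$,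 $\nu\in(1/4,3/4)$, $\xi\in H_\chi$, let $W\colon[0,T]\times\Omega\to H_{-\nu}$ be an $\operatorname{Id}_H$-cylindrical Wiener process, let $S_N\in L(H_{-\nu})$, $N\in\mathbb{N}$, be linear operators which satisfy for all $N\in\mathbb{N}$, $r\in[-\nu,\infty)$, $v,u\in H$ that $S_N(H_r)\subseteq H_{r+1}$, $\sup_{M\in\mathbb{N}}\sup_{s\in[0,1]}\sup_{w\in H,\|w\|_H\le1}M^{-s}\|S_Mw\|_{H_s}<\infty$, $S_Ne_0=e_0$, $(\eta-A)^{-\nu}S_Nv=S_N(\eta-A)^{-\nu}v$, $\langle S_Nu,v\rangle_H=\langle u,S_Nv\rangle_H$, and $P_NS_Nv=S_NP_Nv$, and let $Y^N\colon\{0,1,\dots,N\}\times\Omega\to H$, $N\in\mathbb{N}$, be stochastic processes which satisfy for all $N\in\mathbb{N}$, $n\in\{0,1,\dots,N-1\}$ that $Y^N_0=P_N(\xi)$ and $$Y^N_{n+1}=P_NS_N\Big(Y^N_n+\tfrac{T}{N}\Big(\sum_{k=0}^{q}a_k\,[Y^N_n]^k\Big)+\big(W_{(n+1)T/N}-W_{nT/N}\big)\Big).$$ Then it holds for all $p\in(0,\infty)$ that $\liminf_{N\to\infty}\mathbb{E}\big[\|Y^N_N\|_H^p\big]=\infty$.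
   Context: $\mathbb{N}=\{1,2,3,\dots\}$. $L(V,W)$ denotes the bounded linear operators from $V$ to $W$ and $L(V)=L(V,V)$. Interpolation spaces associated to $\eta-A$: for $r\ge0$, $H_r=D((\eta-A)^r)$ with $\langle v,w\rangle_{H_r}=\langle(\eta-A)^rv,(\eta-A)^rw\rangle_H$; for $r<0$, $H_r$ is the completion of $H$ with respect to the norm $\|(\eta-A)^rv\|_H$; in particular $H_0=H$, $H_1=D(A)$, $H_r\subseteq H_s$ for $r\ge s$, and fractional powers $(\eta-A)^r$ are extended to isometries $H_s\to H_{s-r}$. An $\operatorname{Id}_H$-cylindrical Wiener process is an $H_{-\nu}$-valued process of the form $W_t=\sum_{n\in\mathbb{Z}}\beta^n_te_n$ (convergence in $H_{-\nu}$) with $\beta^n$, $n\in\mathbb{Z}$, independent standard real Brownian motions. $[v]^k$ denotes the pointwise $k$-th power of a function $v$ (with $[v]^0=1$). *)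

theory Defs
  imports "HOL-Probability.Probability"
begin

abbreviation unit_lborel :: "real measure" where
  "unit_lborel \<equiv> restrict_space lborel {0<..<1}"

definition sq_integrable :: "(real \<Rightarrow> real) \<Rightarrow> bool" where
  "sq_integrable f \<longleftrightarrow> f \<in> borel_measurable unit_lborel \<and> integrable unit_lborel (\<lambda>x. (f x)\<^sup>2)"

definition ae_equal :: "(real \<Rightarrow> real) \<Rightarrow> (real \<Rightarrow> real) \<Rightarrow> bool" where
  "ae_equal f g \<longleftrightarrow> sq_integrable f \<and> sq_integrable g \<and> (AE x in unit_lborel. f x = g x)"

lemma sq_integrable_zero: "sq_integrable (\<lambda>x. 0)"
  by (simp add: sq_integrable_def)

quotient_type L2 = "real \<Rightarrow> real" / partial: ae_equal
proof (rule part_equivpI)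
  show "\<exists>f. ae_equal f f"
    by (rule exI[of _ "\<lambda>x. 0"]) (simp add: ae_equal_def sq_integrable_zero)
  show "symp ae_equal"
    by (auto simp: symp_def ae_equal_def)
  show "transp ae_equal"
    by (auto simp: transp_def ae_equal_def elim: AE_mp)
qed

lemma sq_integrable_mult:
  assumes "sq_integrable f" "sq_integrable g"
  shows "integrable unit_lborel (\<lambda>x. f x * g x)"
proof (rule Bochner_Integration.integrable_bound)
  show "integrable unit_lborel (\<lambda>x. (f x)\<^sup>2 + (g x)\<^sup>2)"
    using assms by (auto simp: sq_integrable_def)
  show "(\<lambda>x. f x * g x) \<in> borel_measurable unit_lborel"
    using assms by (auto simp: sq_integrable_def)
  have "\<bar>a * b\<bar> \<le> a\<^sup>2 + b\<^sup>2" for a b :: real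
  proof -
    have "2 * (\<bar>a\<bar> * \<bar>b\<bar>) \<le> a\<^sup>2 + b\<^sup>2"
      using sum_squares_bound[of "\<bar>a\<bar>" "\<bar>b\<bar>"] by (simp add: mult.assoc)
    moreover have "0 \<le> \<bar>a\<bar> * \<bar>b\<bar>" by simp
    ultimately show ?thesis unfolding abs_mult by linarith
  qed
  then show "AE x in unit_lborel. norm (f x * g x) \<le> norm ((f x)\<^sup>2 + (g x)\<^sup>2)"
    by (auto intro!: AE_I2)
qed

lemma sq_integrable_scale:
  assumes "sq_integrable f" shows "sq_integrable (\<lambda>x. c * f x)"
  using assms by (auto simp: sq_integrable_def power_mult_distrib)

lemma sq_integrable_add:
  assumes "sq_integrable f" "sq_integrable g" shows "sq_integrable (\<lambda>x. f x + g x)"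
  using assms sq_integrable_mult[OF assms]
  by (auto simp: sq_integrable_def power2_sum mult.assoc)

instantiation L2 :: real_vector
begin

lift_definition zero_L2 :: L2 is "\<lambda>x. 0"
  by (simp add: ae_equal_def sq_integrable_zero)

lift_definition plus_L2 :: "L2 \<Rightarrow> L2 \<Rightarrow> L2" is "\<lambda>f g x. f x + g x"
  by (auto simp: ae_equal_def intro: sq_integrable_add elim: AE_mp)

lift_definition scaleR_L2 :: "real \<Rightarrow> L2 \<Rightarrow> L2" is "\<lambda>c f x. c * f x"
  by (auto simp: ae_equal_def intro: sq_integrable_scale elim: AE_mp)

definition uminus_L2 :: "L2 \<Rightarrow> L2" where "uminus_L2 v = (-1) *\<^sub>R v"

definition minus_L2 :: "L2 \<Rightarrow> L2 \<Rightarrow> L2" where "minus_L2 v w = v + - w" for v w :: L2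

instance
proof
  fix u v w :: L2 and a b :: real
  show "u + v + w = u + (v + w)"
    by transfer (auto simp: ae_equal_def algebra_simps intro!: sq_integrable_add)
  show "u + v = v + u"
    by transfer (auto simp: ae_equal_def algebra_simps intro!: sq_integrable_add)
  show "0 + u = u"
    by transfer (auto simp: ae_equal_def)
  show "- u + u = 0"
    unfolding uminus_L2_def
    by transfer (auto simp: ae_equal_def sq_integrable_zero)
  show "u - v = u + - v"
    by (simp add: minus_L2_def)
  show "a *\<^sub>R (u + v) = a *\<^sub>R u + a *\<^sub>R v"
    by transfer (auto simp: ae_equal_def distrib_left intro!: sq_integrable_add sq_integrable_scale
        dest: sq_integrable_scale[of _ a])
  show "(a + b) *\<^sub>R u = a *\<^sub>R u + b *\<^sub>R u"
    by transfer (auto simp: ae_equal_def distrib_right intro!: sq_integrable_add sq_integrable_scale)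
  show "a *\<^sub>R b *\<^sub>R u = (a * b) *\<^sub>R u"
    by transfer (auto simp: ae_equal_def mult.assoc intro!: sq_integrable_scale)
  show "1 *\<^sub>R u = u"
    by transfer (auto simp: ae_equal_def)
qed

end

instantiation L2 :: real_inner
begin

lift_definition inner_L2 :: "L2 \<Rightarrow> L2 \<Rightarrow> real" is "\<lambda>f g. \<integral>x. f x * g x \<partial>unit_lborel"
  by (rule integral_cong_AE) (auto simp: ae_equal_def sq_integrable_def elim: AE_mp)

definition norm_L2 :: "L2 \<Rightarrow> real" where "norm_L2 v = sqrt (inner v v)"

definition dist_L2 :: "L2 \<Rightarrow> L2 \<Rightarrow> real" where "dist_L2 v w = norm (v - w)"

definition sgn_L2 :: "L2 \<Rightarrow> L2" where "sgn_L2 v = inverse (norm v) *\<^sub>R v"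

definition uniformity_L2 :: "(L2 \<times> L2) filter" where
  "uniformity_L2 = (INF e\<in>{0<..}. principal {(v, w). dist v w < e})"

definition open_L2 :: "L2 set \<Rightarrow> bool" where
  "open_L2 U \<longleftrightarrow> (\<forall>v\<in>U. eventually (\<lambda>(v', w). v' = v \<longrightarrow> w \<in> U) uniformity)"

instance
proof
  fix u v w :: L2 and a :: real and U :: "L2 set"
  show "dist u v = norm (u - v)" by (rule dist_L2_def)
  show "sgn u = inverse (norm u) *\<^sub>R u" by (rule sgn_L2_def)
  show "uniformity = (INF e\<in>{0<..}. principal {(v, w :: L2). dist v w < e})"
    by (rule uniformity_L2_def)
  show "open U \<longleftrightarrow> (\<forall>v\<in>U. \<forall>\<^sub>F (v', w) in uniformity. v' = v \<longrightarrow> w \<in> U)"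
    by (rule open_L2_def)
  show "norm u = sqrt (inner u u)" by (rule norm_L2_def)
  show "inner u v = inner v u"
    by transfer (simp add: mult.commute)
  show "inner (u + v) w = inner u w + inner v w"
    by transfer (simp add: ae_equal_def distrib_right sq_integrable_mult)
  show "inner (a *\<^sub>R u) v = a * inner u v"
    by transfer (simp add: ae_equal_def mult.assoc)
  show "0 \<le> inner u u"
    by transfer simp
  show "inner u u = 0 \<longleftrightarrow> u = 0"
  proof transfer
    fix f assume "ae_equal f f"
    then have f: "sq_integrable f" by (simp add: ae_equal_def)
    have "(\<integral>x. f x * f x \<partial>unit_lborel) = 0 \<longleftrightarrow> (AE x in unit_lborel. f x * f x = 0)"
      by (rule integral_nonneg_eq_0_iff_AE) (use f in \<open>auto intro: sq_integrable_mult\<close>)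
    then show "(\<integral>x. f x * f x \<partial>unit_lborel) = 0 \<longleftrightarrow> ae_equal f (\<lambda>x. 0)"
      using f by (simp add: ae_equal_def sq_integrable_zero)
  qed
qed

end

(* The class of f; the value 0 for functions f that are not square integrable is a dummy. *)
lift_definition L2_of :: "(real \<Rightarrow> real) \<Rightarrow> L2" is
  "\<lambda>f. if sq_integrable f then f else (\<lambda>x. 0)"
  by (simp add: ae_equal_def sq_integrable_zero)

(* Pointwise k-th power of (a representative of) v. It lies in the space only if v is in
   L^(2k), which holds in particular for all v with a bounded representative. *)
definition L2_power :: "L2 \<Rightarrow> nat \<Rightarrow> L2" where
  "L2_power v k = L2_of (\<lambda>x. rep_L2 v x ^ k)"


(* For a linear operator L that is diagonal with respect to the orthonormal basis b,
   L (b n) = mu_n b n with mu_n > 0: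
     D(L^r) = {v. sum_n |mu_n^r <b n, v>|^2 < infinity},  L^r v = sum_n mu_n^r <b n, v> b n.
   For r < 0 and mu_n bounded away from 0 the domain is the whole space. *)

definition eigenvalue :: "('i \<Rightarrow> 'h::real_inner) \<Rightarrow> ('h \<Rightarrow> 'h) \<Rightarrow> 'i \<Rightarrow> real" where
  "eigenvalue b L n = (THE \<mu>. L (b n) = \<mu> *\<^sub>R b n)"

definition fpow_dom :: "('i \<Rightarrow> 'h::real_inner) \<Rightarrow> ('h \<Rightarrow> 'h) \<Rightarrow> real \<Rightarrow> 'h set" where
  "fpow_dom b L r = {v. (\<lambda>n. \<bar>eigenvalue b L n powr r * inner (b n) v\<bar>\<^sup>2) summable_on UNIV}"

definition fpow :: "('i \<Rightarrow> 'h::real_inner) \<Rightarrow> ('h \<Rightarrow> 'h) \<Rightarrow> real \<Rightarrow> 'h \<Rightarrow> 'h" where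
  "fpow b L r v = (\<Sum>\<^sub>\<infinity>n. (eigenvalue b L n powr r * inner (b n) v) *\<^sub>R b n)"

(* Inner product spaces whose carrier V is a subspace of an ambient vector space. *)

definition inner_product_on :: "'v::real_vector set \<Rightarrow> ('v \<Rightarrow> 'v \<Rightarrow> real) \<Rightarrow> bool" where
  "inner_product_on V ip \<longleftrightarrow> subspace V \<and>
     (\<forall>u\<in>V. \<forall>v\<in>V. ip u v = ip v u) \<and>
     (\<forall>u\<in>V. \<forall>v\<in>V. \<forall>w\<in>V. ip (u + v) w = ip u w + ip v w) \<and>
     (\<forall>c. \<forall>u\<in>V. \<forall>v\<in>V. ip (c *\<^sub>R u) v = c * ip u v) \<and>
     (\<forall>u\<in>V. 0 \<le> ip u u \<and> (ip u u = 0 \<longrightarrow> u = 0))"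

definition ip_norm :: "('v \<Rightarrow> 'v \<Rightarrow> real) \<Rightarrow> 'v \<Rightarrow> real" where
  "ip_norm ip v = sqrt (ip v v)"

(* Metric_space demands nonnegativity and symmetry of the distance also outside the carrier,
   where ip is arbitrary; hence the value 0 there. *)
definition ip_dist :: "'v::real_vector set \<Rightarrow> ('v \<Rightarrow> 'v \<Rightarrow> real) \<Rightarrow> 'v \<Rightarrow> 'v \<Rightarrow> real" where
  "ip_dist V ip v w = (if v \<in> V \<and> w \<in> V then ip_norm ip (v - w) else 0)"

lemma Metric_space_ip_dist:
  assumes "inner_product_on V ip"
  shows "Metric_space V (ip_dist V ip)"
proof -
  have sub: "subspace V" and comm: "\<And>u v. u \<in> V \<Longrightarrow> v \<in> V \<Longrightarrow> ip u v = ip v u"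
    and add: "\<And>u v w. u \<in> V \<Longrightarrow> v \<in> V \<Longrightarrow> w \<in> V \<Longrightarrow> ip (u + v) w = ip u w + ip v w"
    and scale: "\<And>c u v. u \<in> V \<Longrightarrow> v \<in> V \<Longrightarrow> ip (c *\<^sub>R u) v = c * ip u v"
    and nonneg: "\<And>u. u \<in> V \<Longrightarrow> 0 \<le> ip u u" and definite: "\<And>u. u \<in> V \<Longrightarrow> ip u u = 0 \<Longrightarrow> u = 0"
    using assms by (auto simp: inner_product_on_def)
  have quad: "ip (u + c *\<^sub>R v) (u + c *\<^sub>R v) = ip u u + 2 * c * ip u v + c\<^sup>2 * ip v v"
    if u: "u \<in> V" and v: "v \<in> V" for u v c
  proof -
    have cv: "c *\<^sub>R v \<in> V" and s: "u + c *\<^sub>R v \<in> V"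
      using sub u v by (auto simp: subspace_def)
    have "ip w (u + c *\<^sub>R v) = ip w u + c * ip w v" if "w \<in> V" for w
      using add[OF u cv that] scale[OF v that] comm[OF that s] comm[OF that u] comm[OF that v]
      by simp
    then show ?thesis
      using add[OF u cv s] scale[OF v s] u v comm[OF u v]
      by (simp add: algebra_simps power2_eq_square)
  qed
  have CS: "ip u v \<le> sqrt (ip u u) * sqrt (ip v v)" if u: "u \<in> V" and v: "v \<in> V" for u v
  proof (cases "ip v v = 0")
    case True
    then have "v = 0 *\<^sub>R v" using definite v by simp
    then have "ip v u = 0" using scale[OF v u, of 0] by simp
    then show ?thesis using comm[OF u v] True by simp
  next
    case False
    then have pos: "ip v v > 0" using nonneg[OF v] by simp
    have "0 \<le> ip (u + (- ip u v / ip v v) *\<^sub>R v) (u + (- ip u v / ip v v) *\<^sub>R v)"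
      using sub u v by (intro nonneg subspace_add subspace_scale)
    also have "\<dots> = ip u u - (ip u v)\<^sup>2 / ip v v"
      unfolding quad[OF u v] using pos by (simp add: field_simps power2_eq_square)
    finally have "(ip u v)\<^sup>2 \<le> ip u u * ip v v"
      using pos by (simp add: field_simps)
    then have "\<bar>ip u v\<bar> \<le> sqrt (ip u u * ip v v)"
      by (metis real_sqrt_abs real_sqrt_le_iff)
    then show ?thesis by (simp add: real_sqrt_mult)
  qed
  have tri: "ip_norm ip (u + v) \<le> ip_norm ip u + ip_norm ip v" if u: "u \<in> V" and v: "v \<in> V" for u v
  proof -
    have "ip (u + v) (u + v) \<le> (sqrt (ip u u) + sqrt (ip v v))\<^sup>2"
      using quad[OF u v, of 1] CS[OF u v] nonneg[OF u] nonneg[OF v] by (simp add: power2_sum)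
    then have "sqrt (ip (u + v) (u + v)) \<le> sqrt ((sqrt (ip u u) + sqrt (ip v v))\<^sup>2)"
      by (rule real_sqrt_le_mono)
    then show ?thesis using nonneg[OF u] nonneg[OF v] by (simp add: ip_norm_def)
  qed
  have diff: "u - v \<in> V" if "u \<in> V" "v \<in> V" for u v
    using sub that by (rule subspace_diff)
  have sym: "ip_norm ip (u - v) = ip_norm ip (v - u)" if "u \<in> V" "v \<in> V" for u v
  proof -
    have "ip (u - v) (u - v) = ip (0 + (- 1) *\<^sub>R (v - u)) (0 + (- 1) *\<^sub>R (v - u))" by simp
    also have "\<dots> = ip (v - u) (v - u)"
      using quad[OF subspace_0[OF sub] diff[OF that(2,1)], of "-1"]
        scale[OF subspace_0[OF sub] diff[OF that(2,1)], of 0]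
        scale[OF subspace_0[OF sub] subspace_0[OF sub], of 0] by simp
    finally show ?thesis by (simp add: ip_norm_def)
  qed
  show ?thesis
  proof
    fix x y
    show "0 \<le> ip_dist V ip x y"
      by (auto simp: ip_dist_def ip_norm_def nonneg diff)
    show "ip_dist V ip x y = ip_dist V ip y x"
      using sym by (auto simp: ip_dist_def)
  next
    fix x y assume "x \<in> V" "y \<in> V"
    moreover have "ip 0 0 = 0"
      using scale[OF subspace_0[OF sub] subspace_0[OF sub], of 0] by simp
    ultimately show "ip_dist V ip x y = 0 \<longleftrightarrow> x = y"
      using definite[of "x - y"] diff[of x y] by (auto simp: ip_dist_def ip_norm_def)
  next
    fix x y z assume "x \<in> V" "y \<in> V" "z \<in> V"
    then show "ip_dist V ip x z \<le> ip_dist V ip x y + ip_dist V ip y z"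
      using tri[of "x - y" "y - z"] by (simp add: ip_dist_def diff)
  qed
qed

definition ip_topology :: "'v::real_vector set \<Rightarrow> ('v \<Rightarrow> 'v \<Rightarrow> real) \<Rightarrow> 'v topology" where
  "ip_topology V ip = Metric_space.mtopology V (ip_dist V ip)"

definition ip_borel :: "'v::real_vector set \<Rightarrow> ('v \<Rightarrow> 'v \<Rightarrow> real) \<Rightarrow> 'v measure" where
  "ip_borel V ip = sigma V {U. openin (ip_topology V ip) U}"

definition bounded_linear_between ::
    "'v::real_vector set \<Rightarrow> ('v \<Rightarrow> 'v \<Rightarrow> real) \<Rightarrow> 'w::real_vector set \<Rightarrow> ('w \<Rightarrow> 'w \<Rightarrow> real) \<Rightarrow> ('v \<Rightarrow> 'w) \<Rightarrow> bool"
  where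
  "bounded_linear_between V ip V' ip' F \<longleftrightarrow>
     F ` V \<subseteq> V' \<and>
     (\<forall>u\<in>V. \<forall>v\<in>V. F (u + v) = F u + F v) \<and>
     (\<forall>c. \<forall>v\<in>V. F (c *\<^sub>R v) = c *\<^sub>R F v) \<and>
     (\<exists>C. \<forall>v\<in>V. ip_norm ip' (F v) \<le> C * ip_norm ip v)"

(* Hs r with inner product ip r, r real, is a family of interpolation spaces associated to L.
   All spaces are subspaces of one ambient vector space 'v, and J is the canonical
   embedding of the Hilbert space 'h = H_0 into it.  For r < 0, Hs r is a completion of J(H)
   under |L^r v|; the last clause makes the completions for different r compatible. *)
definition interpolation_spaces ::
    "('i \<Rightarrow> 'h::real_inner) \<Rightarrow> ('h \<Rightarrow> 'h) \<Rightarrow> ('h \<Rightarrow> 'v::real_vector) \<Rightarrow>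
     (real \<Rightarrow> 'v set) \<Rightarrow> (real \<Rightarrow> 'v \<Rightarrow> 'v \<Rightarrow> real) \<Rightarrow> bool"
  where
  "interpolation_spaces b L J Hs ip \<longleftrightarrow>
     linear J \<and> inj J \<and>
     (\<forall>r\<ge>0. Hs r = J ` fpow_dom b L r \<and>
        (\<forall>v\<in>fpow_dom b L r. \<forall>w\<in>fpow_dom b L r.
           ip r (J v) (J w) = inner (fpow b L r v) (fpow b L r w))) \<and>
     (\<forall>r<0. inner_product_on (Hs r) (ip r) \<and>
        range J \<subseteq> Hs r \<and>
        (\<forall>v w. ip r (J v) (J w) = inner (fpow b L r v) (fpow b L r w)) \<and>
        ip_topology (Hs r) (ip r) closure_of range J = Hs r \<and>
        Metric_space.mcomplete (Hs r) (ip_dist (Hs r) (ip r))) \<and>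
     (\<forall>r s. s \<le> r \<longrightarrow> bounded_linear_between (Hs r) (ip r) (Hs s) (ip s) (\<lambda>v. v))"


definition std_brownian_motion :: "'a measure \<Rightarrow> real \<Rightarrow> (real \<Rightarrow> 'a \<Rightarrow> real) \<Rightarrow> bool" where
  "std_brownian_motion M T \<beta> \<longleftrightarrow>
     (\<forall>t\<in>{0..T}. \<beta> t \<in> borel_measurable M) \<and>
     (AE \<omega> in M. \<beta> 0 \<omega> = 0) \<and>
     (\<forall>s t. 0 \<le> s \<and> s < t \<and> t \<le> T \<longrightarrow>
        distributed M lborel (\<lambda>\<omega>. \<beta> t \<omega> - \<beta> s \<omega>) (normal_density 0 (sqrt (t - s)))) \<and>
     (\<forall>(m::nat) \<tau>. 0 \<le> \<tau> 0 \<and> (\<forall>i<m. \<tau> i \<le> \<tau> (Suc i)) \<and> \<tau> m \<le> T \<longrightarrow>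
        prob_space.indep_vars M (\<lambda>_. borel) (\<lambda>i \<omega>. \<beta> (\<tau> (Suc i)) \<omega> - \<beta> (\<tau> i) \<omega>) {..<m}) \<and>
     (AE \<omega> in M. continuous_on {0..T} (\<lambda>t. \<beta> t \<omega>))"

(* W_t = sum_n beta^n_t b_n, t in [0,T], the (unconditional) series converging almost surely
   in V for each t.  Independence of the processes beta^n is independence of the
   path-valued random variables with respect to the product sigma-algebra. *)
definition cylindrical_wiener ::
    "'a measure \<Rightarrow> real \<Rightarrow> 'v::real_vector set \<Rightarrow> ('v \<Rightarrow> 'v \<Rightarrow> real) \<Rightarrow> ('i \<Rightarrow> 'v) \<Rightarrow> (real \<Rightarrow> 'a \<Rightarrow> 'v) \<Rightarrow> bool"
  where
  "cylindrical_wiener M T V ip b W \<longleftrightarrow>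
     (\<forall>t\<in>{0..T}. W t \<in> measurable M (ip_borel V ip)) \<and>
     (\<exists>\<beta>. (\<forall>n. std_brownian_motion M T (\<beta> n)) \<and>
        prob_space.indep_vars M (\<lambda>_. PiM {0..T} (\<lambda>_. borel))
          (\<lambda>n \<omega>. \<lambda>t\<in>{0..T}. \<beta> n t \<omega>) UNIV \<and>
        (\<forall>t\<in>{0..T}. AE \<omega> in M.
           limitin (ip_topology V ip) (\<lambda>F. \<Sum>n\<in>F. \<beta> n t \<omega> *\<^sub>R b n) (W t \<omega>)
             (finite_subsets_at_top UNIV)))"

end

theory Submission
  imports Defs
begin

text \<open>The divergence is driven by the constant mode alone. Write \<open>Y\<^sub>n = y\<^sub>n e\<^sub>0 + Z\<^sub>n\<close> with
  \<open>Z\<^sub>n\<close> orthogonal to \<open>e\<^sub>0\<close>. Since \<open>S\<^sub>N\<close> is symmetric and fixes \<open>e\<^sub>0\<close>, the number \<open>y\<^sub>n\<close> evolves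
  by the plain explicit Euler recursion. If \<open>Z\<^sub>n\<close> is uniformly small compared with \<open>y\<^sub>n\<close>, and \<open>\<bar>y\<^sub>n\<bar>\<close>
  exceeds a certain multiple of \<open>N\<close>, the leading monomial wins: \<open>\<bar>y\<^bsub>n+1\<^esub>\<bar>\<close> is at least
  a constant times \<open>\<bar>y\<^sub>n\<bar>\<^sup>q / N\<close>. As \<open>q \<ge> 2\<close>, this iterates to
  \<open>\<bar>y\<^sub>N\<bar> \<ge> 2 ^ 2 ^ (N - 1)\<close>.

  For odd \<open>q\<close> the mean of \<open>[Y\<^sub>n]\<^sup>q\<close> says nothing about \<open>y\<^sub>n\<close> unless \<open>Z\<^sub>n\<close> stays small. Both \<open>y\<^sub>n\<close>
  and \<open>Z\<^sub>n\<close> are amplified by a factor of order \<open>\<bar>y\<^sub>n\<bar> ^ (q - 1)\<close>, up to powers of \<open>N\<close>; hence the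
  ratio \<open>\<parallel>Z\<^sub>n\<parallel> / \<bar>y\<^sub>n\<bar>\<close> grows at most by a factor \<open>\<Theta> N\<close> in each step (\<open>euler_step\<close>,
  \<open>euler_blow_up\<close>). It therefore suffices that the first noise increment moves the scheme to
  within about \<open>(\<Theta> N) ^ (- N)\<close> of a large constant function, and that all later increments of the
  modes \<open>\<bar>m\<bar> \<le> N\<close> are as small as that.

  This prescribes \<open>N (2 N + 1)\<close> independent Gaussian variables up to an error that is only
  exponentially small in \<open>N log N\<close>, with targets growing polynomially in \<open>N\<close>. The event has
  probability at least \<open>exp (- D N ^ (2 q + 3))\<close> (\<open>brownian_tube_prob_ge\<close>,
  \<open>tube_prob_lower_exp\<close>), which the doubly exponential size of \<open>Y\<^sub>N\<close> on it outweighs.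

  The modes of the noise are reached through \<open>H\<^bsub>-\<nu>\<^esub>\<close>. Its inner product is definite, which forces
  the series of the fractional power \<open>(\<eta> - A)\<^bsup>-\<nu>\<^esup>\<close> to converge; so each Fourier coefficient is
  continuous in the norm of \<open>H\<^bsub>-\<nu>\<^esub>\<close>, and the symmetry of \<open>S\<^sub>N\<close> shows that
  \<open>P\<^sub>N S\<^sub>N W\<^sub>t\<close> depends on finitely many of the Brownian motions only (\<open>smoothed_limit\<close>).\<close>

section \<open>The trigonometric system in \<open>L\<^sup>2(0,1)\<close>\<close>

lemma prob_space_unit_lborel: "prob_space unit_lborel"
  by (rule prob_spaceI) (simp add: emeasure_restrict_space)

lemma integrable_unit_bounded:
  fixes f :: "real \<Rightarrow> real"
  assumes "f \<in> borel_measurable borel" "\<And>x. \<bar>f x\<bar> \<le> B"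
  shows "integrable unit_lborel f"
proof -
  interpret prob_space unit_lborel by (rule prob_space_unit_lborel)
  have "f \<in> borel_measurable unit_lborel"
    using assms(1) by (simp add: measurable_restrict_space1)
  then show ?thesis
    using assms(2) by (intro integrable_const_bound[where B=B]) auto
qed

lemma sq_integrable_bounded:
  assumes "f \<in> borel_measurable borel" "\<And>x. \<bar>f x\<bar> \<le> B"
  shows "sq_integrable f"
proof -
  have "(\<lambda>x. (f x)\<^sup>2) \<in> borel_measurable borel" using assms(1) by measurable
  moreover have "\<bar>(f x)\<^sup>2\<bar> \<le> B\<^sup>2" for x
    using assms(2)[of x] power_mono[of "\<bar>f x\<bar>" B 2] by simp
  ultimately have "integrable unit_lborel (\<lambda>x. (f x)\<^sup>2)"
    by (rule integrable_unit_bounded)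
  then show ?thesis
    using assms(1) by (simp add: sq_integrable_def measurable_restrict_space1)
qed

lemma L2_of_eq_abs: "sq_integrable f \<Longrightarrow> L2_of f = abs_L2 f"
  by (simp add: L2_of_def)

lemma inner_L2_of:
  assumes "sq_integrable f" "sq_integrable g"
  shows "inner (L2_of f) (L2_of g) = (\<integral>x. f x * g x \<partial>unit_lborel)"
  using assms by transfer simp

lemma L2_of_add:
  "sq_integrable f \<Longrightarrow> sq_integrable g \<Longrightarrow> L2_of (\<lambda>x. f x + g x) = L2_of f + L2_of g"
  by transfer (auto simp: ae_equal_def sq_integrable_add)

lemma L2_of_scale: "sq_integrable f \<Longrightarrow> L2_of (\<lambda>x. c * f x) = c *\<^sub>R L2_of f"
  by transfer (auto simp: ae_equal_def sq_integrable_scale)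

lemma L2_of_zero: "L2_of (\<lambda>x. 0) = 0"
  by transfer (auto simp: ae_equal_def sq_integrable_zero)

lemma sq_integrable_sum:
  assumes "finite I" "\<And>i. i \<in> I \<Longrightarrow> sq_integrable (f i)"
  shows "sq_integrable (\<lambda>x. \<Sum>i\<in>I. c i * f i x)"
  using assms by (induction I) (auto intro!: sq_integrable_add sq_integrable_scale sq_integrable_zero)

lemma L2_of_sum:
  assumes "finite I" "\<And>i. i \<in> I \<Longrightarrow> sq_integrable (f i)"
  shows "L2_of (\<lambda>x. \<Sum>i\<in>I. c i * f i x) = (\<Sum>i\<in>I. c i *\<^sub>R L2_of (f i))"
  using assms
proof (induction I)
  case (insert i I)
  then show ?case
    by (simp add: L2_of_add L2_of_scale sq_integrable_scale sq_integrable_sum)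
qed (simp add: L2_of_zero)

text \<open>\<open>L2_power\<close> is computed from an arbitrary representative, which agrees with the bounded function
  \<open>f\<close> almost everywhere only; its \<open>k\<close>-th power is then square integrable as well, so the dummy value
  of \<open>L2_of\<close> does not occur.\<close>
lemma L2_power_L2_of:
  assumes "f \<in> borel_measurable borel" "\<And>x. \<bar>f x\<bar> \<le> B"
  shows "L2_power (L2_of f) k = L2_of (\<lambda>x. f x ^ k)"
proof -
  let ?g = "rep_L2 (L2_of f)"
  have sq: "sq_integrable f" using assms by (rule sq_integrable_bounded)
  have "ae_equal f f" using sq by (simp add: ae_equal_def)
  have "ae_equal ?g f"
    unfolding L2_of_eq_abs[OF sq] using Quotient3_L2 \<open>ae_equal f f\<close> unfolding Quotient3_def by blast
  then have g: "sq_integrable ?g" and ae: "AE x in unit_lborel. ?g x = f x"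
    by (auto simp: ae_equal_def)
  have mk: "(\<lambda>x. f x ^ k) \<in> borel_measurable borel" using assms(1) by measurable
  have bk: "\<bar>f x ^ k\<bar> \<le> B ^ k" for x
    using assms(2)[of x] by (simp add: power_abs power_mono)
  have sqk: "sq_integrable (\<lambda>x. f x ^ k)" using mk bk by (rule sq_integrable_bounded)
  have mg: "(\<lambda>x. ?g x ^ k) \<in> borel_measurable unit_lborel"
    using g by (auto simp: sq_integrable_def)
  have "integrable unit_lborel (\<lambda>x. (?g x ^ k)\<^sup>2) \<longleftrightarrow> integrable unit_lborel (\<lambda>x. (f x ^ k)\<^sup>2)"
    using mg sqk ae by (intro integrable_cong_AE) (auto simp: sq_integrable_def)
  then have "sq_integrable (\<lambda>x. ?g x ^ k)" using mg sqk by (simp add: sq_integrable_def)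
  then have "ae_equal (\<lambda>x. ?g x ^ k) (\<lambda>x. f x ^ k)"
    using sqk ae by (auto simp: ae_equal_def)
  then have "abs_L2 (\<lambda>x. ?g x ^ k) = abs_L2 (\<lambda>x. f x ^ k)"
    using Quotient3_L2 unfolding Quotient3_def by blast
  then show ?thesis
    unfolding L2_power_def using sqk \<open>sq_integrable (\<lambda>x. ?g x ^ k)\<close>
    by (simp add: L2_of_eq_abs)
qed

lemma norm_L2_of_le:
  assumes "f \<in> borel_measurable borel" "\<And>x. \<bar>f x\<bar> \<le> B"
  shows "norm (L2_of f) \<le> B"
proof -
  interpret prob_space unit_lborel by (rule prob_space_unit_lborel)
  have sq: "sq_integrable f" using assms by (rule sq_integrable_bounded)
  have "0 \<le> B" using assms(2)[of 0] by linarith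
  have "f x * f x \<le> B\<^sup>2" for x
    using assms(2)[of x] power_mono[of "\<bar>f x\<bar>" B 2] by (simp add: power2_eq_square)
  then have "inner (L2_of f) (L2_of f) \<le> (\<integral>x. B\<^sup>2 \<partial>unit_lborel)"
    unfolding inner_L2_of[OF sq sq]
    using sq by (intro integral_mono) (auto intro: sq_integrable_mult)
  also have "\<dots> = B\<^sup>2" using prob_space by simp
  finally show ?thesis
    using \<open>0 \<le> B\<close> by (simp add: norm_L2_def real_le_lsqrt)
qed

definition trig :: "int \<Rightarrow> real \<Rightarrow> real" where
  "trig n x = (if n = 0 then 1
     else if 0 < n then sqrt 2 * cos (2 * of_int n * pi * x)
     else sqrt 2 * sin (2 * of_int (- n) * pi * x))"

lemma trig_measurable [measurable]: "trig n \<in> borel_measurable borel"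
  unfolding trig_def by (cases "n = 0"; cases "0 < n") simp_all

lemma abs_trig_le: "\<bar>trig n x\<bar> \<le> 2"
proof -
  have "sqrt 2 * \<bar>c\<bar> \<le> 2" if "\<bar>c\<bar> \<le> 1" for c :: real
  proof -
    have "sqrt 2 * \<bar>c\<bar> \<le> sqrt 2 * 1" using that by (intro mult_left_mono) auto
    also have "sqrt 2 * 1 \<le> 2" using sqrt2_less_2 by simp
    finally show ?thesis .
  qed
  then show ?thesis by (auto simp: trig_def abs_mult)
qed

lemma sq_integrable_trig: "sq_integrable (trig n)"
  using trig_measurable abs_trig_le by (rule sq_integrable_bounded)

lemma integral_unit_antiderivative:
  fixes f F :: "real \<Rightarrow> real"
  assumes "\<And>x. (F has_real_derivative f x) (at x)" "\<And>x. isCont f x"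
  shows "(\<integral>x. f x \<partial>unit_lborel) = F 1 - F 0"
proof -
  have "(\<integral>x. f x \<partial>unit_lborel) = (LBINT x:{0<..<1}. f x)"
    by (simp add: integral_restrict_space set_lebesgue_integral_def)
  also have "\<dots> = (LBINT x=0..1. f x)"
    using einterval_eq(1)[of 0 1] by (simp add: interval_lebesgue_integral_def zero_ereal_def one_ereal_def)
  also have "\<dots> = F 1 - F 0"
    using interval_integral_FTC_finite[of 0 1 f F] assms
    by (auto simp: has_real_derivative_iff_has_vector_derivative has_vector_derivative_at_within
        zero_ereal_def one_ereal_def
        intro!: continuous_at_imp_continuous_on)
  finally show ?thesis .
qed

lemma integral_cos_int:
  "(\<integral>x. cos (2 * of_int k * pi * x) \<partial>unit_lborel) = (if k = 0 then 1 else 0)"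
proof (cases "k = 0")
  case True
  interpret prob_space unit_lborel by (rule prob_space_unit_lborel)
  show ?thesis using True prob_space by simp
next
  case False
  have "(\<integral>x. cos (2 * of_int k * pi * x) \<partial>unit_lborel)
      = sin (2 * of_int k * pi * 1) / (2 * of_int k * pi) - sin (2 * of_int k * pi * 0) / (2 * of_int k * pi)"
    using False by (intro integral_unit_antiderivative) (auto intro!: derivative_eq_intros continuous_intros)
  moreover have "sin (2 * of_int k * pi) = 0"
    using sin_integer_2pi[of "of_int k"] by (simp add: mult.commute mult.left_commute)
  ultimately show ?thesis using False by simp
qed

lemma integral_sin_int: "(\<integral>x. sin (2 * of_int k * pi * x) \<partial>unit_lborel) = 0"
proof (cases "k = 0")
  case False
  have "(\<integral>x. sin (2 * of_int k * pi * x) \<partial>unit_lborel)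
      = - cos (2 * of_int k * pi * 1) / (2 * of_int k * pi) - (- cos (2 * of_int k * pi * 0) / (2 * of_int k * pi))"
    using False by (intro integral_unit_antiderivative) (auto intro!: derivative_eq_intros continuous_intros)
  moreover have "cos (2 * of_int k * pi) = 1"
    using cos_integer_2pi[of "of_int k"] by (simp add: mult.commute mult.left_commute)
  ultimately show ?thesis by simp
qed simp

lemma integral_trig_products:
  fixes j k :: int
  defines "c \<equiv> \<lambda>j x. cos (2 * real_of_int j * pi * x)" and "s \<equiv> \<lambda>j x. sin (2 * real_of_int j * pi * x)"
  shows "(\<integral>x. c j x * c k x \<partial>unit_lborel) = ((if j = k then 1 else 0) + (if j = - k then 1 else 0)) / 2"
    and "(\<integral>x. s j x * s k x \<partial>unit_lborel) = ((if j = k then 1 else 0) - (if j = - k then 1 else 0)) / 2"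
    and "(\<integral>x. s j x * c k x \<partial>unit_lborel) = 0"
proof -
  have int: "integrable unit_lborel (c j)" "integrable unit_lborel (s j)" for j
    unfolding c_def s_def by (rule integrable_unit_bounded[where B = 1]; simp)+
  have arg: "2 * real_of_int j * pi * x - 2 * real_of_int k * pi * x = 2 * real_of_int (j - k) * pi * x"
    "2 * real_of_int j * pi * x + 2 * real_of_int k * pi * x = 2 * real_of_int (j + k) * pi * x" for x
    by (simp_all add: algebra_simps)
  have ic: "(\<integral>x. c j x \<partial>unit_lborel) = (if j = 0 then 1 else 0)" for j
    unfolding c_def by (rule integral_cos_int)
  have isn: "(\<integral>x. s j x \<partial>unit_lborel) = 0" for j
    unfolding s_def by (rule integral_sin_int)
  have "(\<lambda>x. c j x * c k x) = (\<lambda>x. (c (j - k) x + c (j + k) x) / 2)"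
    unfolding c_def cos_times_cos arg ..
  then show "(\<integral>x. c j x * c k x \<partial>unit_lborel) = ((if j = k then 1 else 0) + (if j = - k then 1 else 0)) / 2"
    using int by (simp add: ic eq_neg_iff_add_eq_0)
  have "(\<lambda>x. s j x * s k x) = (\<lambda>x. (c (j - k) x - c (j + k) x) / 2)"
    unfolding c_def s_def sin_times_sin arg ..
  then show "(\<integral>x. s j x * s k x \<partial>unit_lborel) = ((if j = k then 1 else 0) - (if j = - k then 1 else 0)) / 2"
    using int by (simp add: ic eq_neg_iff_add_eq_0)
  have "(\<lambda>x. s j x * c k x) = (\<lambda>x. (s (j + k) x + s (j - k) x) / 2)"
    unfolding c_def s_def sin_times_cos arg ..
  then show "(\<integral>x. s j x * c k x \<partial>unit_lborel) = 0"
    using int by (simp add: isn)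
qed

definition basis :: "int \<Rightarrow> L2" where "basis n = L2_of (trig n)"

lemma inner_basis: "inner (basis m) (basis n) = (if m = n then 1 else 0)"
proof -
  interpret prob_space unit_lborel by (rule prob_space_unit_lborel)
  note prods = integral_trig_products[of "\<bar>m\<bar>" "\<bar>n\<bar>"] integral_trig_products[of "\<bar>n\<bar>" "\<bar>m\<bar>"]
  note single = integral_cos_int[of "\<bar>m\<bar>"] integral_cos_int[of "\<bar>n\<bar>"] integral_sin_int[of "\<bar>m\<bar>"] integral_sin_int[of "\<bar>n\<bar>"]
  have i: "inner (basis m) (basis n) = (\<integral>x. trig m x * trig n x \<partial>unit_lborel)"
    by (simp add: basis_def inner_L2_of sq_integrable_trig)
  have [simp]: "sqrt 2 * a * (sqrt 2 * b) = 2 * (a * b)" for a b :: real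
    by (simp add: algebra_simps flip: mult.assoc)
  consider "m = 0" "n = 0" | "m = 0" "n > 0" | "m = 0" "n < 0" | "m > 0" "n = 0" | "m < 0" "n = 0"
    | "m > 0" "n > 0" | "m < 0" "n > 0" | "m > 0" "n < 0" | "m < 0" "n < 0" by linarith
  then show ?thesis
    unfolding i trig_def using prods single
    by cases (use prob_space in \<open>auto simp: mult.commute[of "cos _" "sin _"]\<close>)
qed

section \<open>Growth of one deterministic step\<close>

definition proj :: "nat \<Rightarrow> L2 \<Rightarrow> L2" where
  "proj N v = (\<Sum>n=- int N..int N. inner (basis n) v *\<^sub>R basis n)"

lemma norm_basis [simp]: "norm (basis n) = 1"
  by (simp add: norm_eq_sqrt_inner inner_basis)

lemma linear_proj: "linear (proj N)"
  by (rule linearI)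
    (simp_all add: proj_def inner_right_distrib scaleR_add_left sum.distrib scaleR_sum_right)

lemma inner_basis_sum:
  assumes "finite I"
  shows "inner (basis m) (\<Sum>n\<in>I. c n *\<^sub>R basis n) = (if m \<in> I then c m else 0)"
  using assms by (simp add: inner_sum_right inner_basis if_distrib cong: if_cong)

lemma inner_basis_proj: "inner (basis m) (proj N v) = (if \<bar>m\<bar> \<le> int N then inner (basis m) v else 0)"
  unfolding proj_def by (subst inner_basis_sum) auto

lemma proj_sum_basis:
  "proj N (\<Sum>n=- int N..int N. c n *\<^sub>R basis n) = (\<Sum>n=- int N..int N. c n *\<^sub>R basis n)"
  unfolding proj_def by (intro sum.cong refl) (simp add: inner_basis_sum)

lemma proj_proj: "proj N (proj N v) = proj N v"
  using proj_sum_basis[of N "\<lambda>n. inner (basis n) v"] by (simp add: proj_def)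

lemma proj_basis: "\<bar>m\<bar> \<le> int N \<Longrightarrow> proj N (basis m) = basis m"
proof -
  assume m: "\<bar>m\<bar> \<le> int N"
  have "proj N (basis m) = (\<Sum>n=- int N..int N. if n = m then basis n else 0)"
    unfolding proj_def by (intro sum.cong) (auto simp: inner_basis)
  then show ?thesis using m by (simp add: abs_le_iff)
qed

lemma norm_proj_le: "norm (proj N v) \<le> norm v"
proof -
  have "inner (proj N v) (proj N v) = (\<Sum>n=- int N..int N. inner (basis n) v * inner (basis n) (proj N v))"
    by (subst (1) proj_def) (simp add: inner_sum_left)
  also have "\<dots> = inner (proj N v) v"
    by (subst (2) proj_def) (auto simp: inner_sum_left inner_basis_proj intro!: sum.cong)
  finally have "norm (proj N v) * norm (proj N v) = inner (proj N v) v"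
    by (simp add: power2_norm_eq_inner flip: power2_eq_square)
  also have "\<dots> \<le> norm (proj N v) * norm v" by (rule norm_cauchy_schwarz)
  finally show ?thesis by (cases "norm (proj N v) = 0") (auto dest: mult_left_le_imp_le)
qed

lemma abs_inner_basis_le: "\<bar>inner (basis n) v\<bar> \<le> norm v"
  using Cauchy_Schwarz_ineq2[of "basis n" v] by simp

text \<open>The trigonometric polynomial representing \<open>proj N v\<close>. Pointwise powers are estimated on this
  representative, whose supremum is controlled by the \<open>L\<^sup>2\<close> norm at the price of a factor \<open>N\<close>.\<close>
definition trig_sum :: "nat \<Rightarrow> L2 \<Rightarrow> real \<Rightarrow> real" where
  "trig_sum N v x = (\<Sum>n=- int N..int N. inner (basis n) v * trig n x)"

lemma trig_sum_measurable [measurable]: "trig_sum N v \<in> borel_measurable borel"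
  unfolding trig_sum_def by measurable

lemma abs_trig_sum_le:
  assumes "N \<ge> 1"
  shows "\<bar>trig_sum N v x\<bar> \<le> 6 * real N * norm v"
proof -
  have "\<bar>trig_sum N v x\<bar> \<le> (\<Sum>n=- int N..int N. \<bar>inner (basis n) v * trig n x\<bar>)"
    unfolding trig_sum_def by (rule sum_abs)
  also have "\<dots> \<le> (\<Sum>n=- int N..int N. norm v * 2)"
    unfolding abs_mult by (intro sum_mono mult_mono abs_inner_basis_le abs_trig_le) auto
  also have "\<dots> = (2 * real N + 1) * (norm v * 2)" by simp
  also have "\<dots> \<le> (3 * real N) * (norm v * 2)"
    using assms by (intro mult_right_mono) auto
  finally show ?thesis by simp
qed

lemma L2_of_trig_sum: "L2_of (trig_sum N v) = proj N v"
  unfolding trig_sum_def proj_def basis_def by (rule L2_of_sum) (auto intro: sq_integrable_trig)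

definition nemytskii :: "(nat \<Rightarrow> real) \<Rightarrow> nat \<Rightarrow> L2 \<Rightarrow> L2" where
  "nemytskii a q v = (\<Sum>k\<le>q. a k *\<^sub>R L2_power v k)"

lemma nemytskii_L2_of:
  assumes m: "g \<in> borel_measurable borel" and b: "\<And>x. \<bar>g x\<bar> \<le> B"
  shows "nemytskii a q (L2_of g) = L2_of (\<lambda>x. \<Sum>k\<le>q. a k * g x ^ k)"
proof -
  have "sq_integrable (\<lambda>x. g x ^ k)" for k
  proof (rule sq_integrable_bounded)
    show "(\<lambda>x. g x ^ k) \<in> borel_measurable borel" using m by measurable
    show "\<bar>g x ^ k\<bar> \<le> B ^ k" for x using b[of x] by (simp add: power_abs power_mono)
  qed
  then show ?thesis
    by (simp add: nemytskii_def L2_power_L2_of[OF m b] L2_of_sum)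
qed

lemma norm_nemytskii_le:
  assumes "proj N v = v" "N \<ge> 1"
  shows "norm (nemytskii a q v) \<le> (\<Sum>k\<le>q. \<bar>a k\<bar> * (6 * real N * norm v) ^ k)"
proof -
  have *: "nemytskii a q v = L2_of (\<lambda>x. \<Sum>k\<le>q. a k * trig_sum N v x ^ k)"
    using nemytskii_L2_of[OF trig_sum_measurable abs_trig_sum_le[OF assms(2)], of a q v] assms(1)
    by (simp add: L2_of_trig_sum)
  show ?thesis unfolding *
  proof (rule norm_L2_of_le)
    fix x
    have "\<bar>\<Sum>k\<le>q. a k * trig_sum N v x ^ k\<bar> \<le> (\<Sum>k\<le>q. \<bar>a k * trig_sum N v x ^ k\<bar>)"
      by (rule sum_abs)
    also have "\<dots> \<le> (\<Sum>k\<le>q. \<bar>a k\<bar> * (6 * real N * norm v) ^ k)"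
      unfolding abs_mult power_abs
      by (intro sum_mono mult_left_mono power_mono abs_trig_sum_le assms) auto
    finally show "\<bar>\<Sum>k\<le>q. a k * trig_sum N v x ^ k\<bar> \<le> (\<Sum>k\<le>q. \<bar>a k\<bar> * (6 * real N * norm v) ^ k)" .
  qed measurable
qed

text \<open>Both sides carry the factor \<open>\<bar>y\<bar>\<close> so that the exponent \<open>k - 1\<close> of the derivative does not appear.\<close>
lemma abs_power_diff_le:
  fixes y z :: real
  assumes "\<bar>z\<bar> \<le> \<bar>y\<bar>"
  shows "\<bar>y\<bar> * \<bar>(y + z) ^ k - y ^ k\<bar> \<le> real k * 2 ^ k * \<bar>y\<bar> ^ k * \<bar>z\<bar>"
proof (induction k)
  case (Suc k)
  have "(y + z) ^ Suc k - y ^ Suc k = (y + z) * ((y + z) ^ k - y ^ k) + z * y ^ k"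
    by (simp add: algebra_simps)
  then have "\<bar>(y + z) ^ Suc k - y ^ Suc k\<bar> \<le> \<bar>y + z\<bar> * \<bar>(y + z) ^ k - y ^ k\<bar> + \<bar>z\<bar> * \<bar>y\<bar> ^ k"
    by (metis abs_mult abs_triangle_ineq power_abs)
  also have "\<dots> \<le> (2 * \<bar>y\<bar>) * \<bar>(y + z) ^ k - y ^ k\<bar> + \<bar>z\<bar> * \<bar>y\<bar> ^ k"
    using assms by (intro add_right_mono mult_right_mono) auto
  also have "\<dots> \<le> 2 * (real k * 2 ^ k * \<bar>y\<bar> ^ k * \<bar>z\<bar>) + \<bar>z\<bar> * \<bar>y\<bar> ^ k"
    using Suc by simp
  also have "\<dots> = (2 * real k * 2 ^ k + 1) * (\<bar>y\<bar> ^ k * \<bar>z\<bar>)" by (simp add: algebra_simps)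
  also have "\<dots> \<le> (real (Suc k) * 2 ^ Suc k) * (\<bar>y\<bar> ^ k * \<bar>z\<bar>)"
  proof (intro mult_right_mono)
    have "(1::real) \<le> 2 * 2 ^ k" using one_le_power[of "2::real" k] by linarith
    then show "2 * real k * 2 ^ k + 1 \<le> real (Suc k) * 2 ^ Suc k"
      by (simp add: algebra_simps)
  qed auto
  finally have "\<bar>y\<bar> * \<bar>(y + z) ^ Suc k - y ^ Suc k\<bar>
      \<le> \<bar>y\<bar> * ((real (Suc k) * 2 ^ Suc k) * (\<bar>y\<bar> ^ k * \<bar>z\<bar>))"
    by (intro mult_left_mono) auto
  then show ?case by (simp add: mult_ac)
qed simp

text \<open>Linearisation of the nonlinearity at a constant function: as long as the perturbation \<open>z\<close> is
  pointwise at most \<open>\<bar>y\<bar>\<close>, the polynomial is Lipschitz there with a constant of order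
  \<open>\<bar>y\<bar> ^ (q - 1)\<close>. As above, the estimate is multiplied by \<open>\<bar>y\<bar>\<close>.\<close>
lemma nemytskii_near_constant:
  fixes a :: "nat \<Rightarrow> real" and v :: L2 and q :: nat
  defines "y \<equiv> inner (basis 0) v"
  defines "z \<equiv> v - y *\<^sub>R basis 0"
  defines "D \<equiv> nemytskii a q v - (\<Sum>k\<le>q. a k * y ^ k) *\<^sub>R basis 0"
  assumes N: "N \<ge> 1" and v: "proj N v = v" and y: "1 \<le> \<bar>y\<bar>" and z: "6 * real N * norm z \<le> \<bar>y\<bar>"
  shows "\<bar>y\<bar> * norm D \<le> (\<Sum>k\<le>q. \<bar>a k\<bar> * real k * 2 ^ k) * \<bar>y\<bar> ^ q * (6 * real N * norm z)"
    (is "_ \<le> ?G * _ * ?Z")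
proof -
  let ?z = "trig_sum N z" and ?f = "\<lambda>u. \<Sum>k\<le>q. a k * u ^ k"
  have pz: "proj N z = z"
    unfolding z_def using v by (simp add: linear_diff[OF linear_proj] linear_scale[OF linear_proj] proj_basis)
  have zb: "\<bar>?z x\<bar> \<le> ?Z" for x using abs_trig_sum_le[OF N] .
  have zy: "\<bar>?z x\<bar> \<le> \<bar>y\<bar>" for x using zb[of x] z by linarith
  have t0: "trig 0 = (\<lambda>x. 1)" by (simp add: trig_def fun_eq_iff)
  have sq1: "sq_integrable (\<lambda>x. 1)" using sq_integrable_trig[of 0] by (simp add: t0)
  have b0: "basis 0 = L2_of (\<lambda>x. 1)" by (simp add: basis_def t0)
  have sqz: "sq_integrable ?z" using trig_sum_measurable zb by (rule sq_integrable_bounded)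
  have "L2_of (\<lambda>x. y * 1 + ?z x) = y *\<^sub>R basis 0 + z"
    using pz by (simp only: L2_of_add L2_of_scale sq_integrable_scale sq1 sqz b0 L2_of_trig_sum)
  then have v_eq: "v = L2_of (\<lambda>x. y + ?z x)" by (simp add: z_def)
  have mz: "(\<lambda>x. y + ?z x) \<in> borel_measurable borel" by measurable
  have bz: "\<bar>y + ?z x\<bar> \<le> 2 * \<bar>y\<bar>" for x using zy[of x] by linarith
  have nem: "nemytskii a q v = L2_of (\<lambda>x. ?f (y + ?z x))"
    using nemytskii_L2_of[OF mz bz] v_eq by simp
  have mf: "(\<lambda>x. ?f (y + ?z x)) \<in> borel_measurable borel" by measurable
  have "\<bar>?f (y + ?z x)\<bar> \<le> (\<Sum>k\<le>q. \<bar>a k\<bar> * (2 * \<bar>y\<bar>) ^ k)" for x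
    unfolding abs_mult power_abs
    by (rule order_trans[OF sum_abs], unfold abs_mult power_abs) (intro sum_mono mult_left_mono power_mono bz; simp)
  with mf have sqf: "sq_integrable (\<lambda>x. ?f (y + ?z x))" by (rule sq_integrable_bounded)
  have "L2_of (\<lambda>x. ?f (y + ?z x) + (- ?f y) * 1) = L2_of (\<lambda>x. ?f (y + ?z x)) + (- ?f y) *\<^sub>R basis 0"
    unfolding b0 by (simp only: L2_of_add[OF sqf sq_integrable_scale[OF sq1]] L2_of_scale[OF sq1])
  then have D: "D = L2_of (\<lambda>x. ?f (y + ?z x) - ?f y)"
    by (simp add: D_def nem)
  have bound: "\<bar>y\<bar> * \<bar>?f (y + ?z x) - ?f y\<bar> \<le> ?G * \<bar>y\<bar> ^ q * ?Z" for x
  proof -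
    have "\<bar>y\<bar> * \<bar>?f (y + ?z x) - ?f y\<bar> = \<bar>\<Sum>k\<le>q. a k * (y * ((y + ?z x) ^ k - y ^ k))\<bar>"
      by (simp add: abs_mult[symmetric] sum_distrib_left algebra_simps flip: sum_subtractf)
    also have "\<dots> \<le> (\<Sum>k\<le>q. \<bar>a k\<bar> * (\<bar>y\<bar> * \<bar>(y + ?z x) ^ k - y ^ k\<bar>))"
      by (rule order_trans[OF sum_abs]) (simp add: abs_mult)
    also have "\<dots> \<le> (\<Sum>k\<le>q. \<bar>a k\<bar> * (real k * 2 ^ k * \<bar>y\<bar> ^ q * ?Z))"
    proof (intro sum_mono mult_left_mono)
      fix k assume k: "k \<in> {..q}"
      have "\<bar>y\<bar> * \<bar>(y + ?z x) ^ k - y ^ k\<bar> \<le> real k * 2 ^ k * \<bar>y\<bar> ^ k * \<bar>?z x\<bar>"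
        by (rule abs_power_diff_le[OF zy])
      also have "\<dots> \<le> real k * 2 ^ k * \<bar>y\<bar> ^ q * ?Z"
        using k y zb by (intro mult_mono power_increasing) auto
      finally show "\<bar>y\<bar> * \<bar>(y + ?z x) ^ k - y ^ k\<bar> \<le> real k * 2 ^ k * \<bar>y\<bar> ^ q * ?Z" .
    qed auto
    also have "\<dots> = ?G * \<bar>y\<bar> ^ q * ?Z"
      by (simp only: sum_distrib_right mult.assoc)
    finally show ?thesis .
  qed
  have "norm D \<le> ?G * \<bar>y\<bar> ^ q * ?Z / \<bar>y\<bar>"
    unfolding D
  proof (rule norm_L2_of_le)
    show "\<bar>?f (y + ?z x) - ?f y\<bar> \<le> ?G * \<bar>y\<bar> ^ q * ?Z / \<bar>y\<bar>" for x
      using bound[of x] y by (subst pos_le_divide_eq) (auto simp: mult.commute)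
  qed measurable
  then show ?thesis using y by (subst (asm) pos_le_divide_eq) (auto simp: mult.commute)
qed

text \<open>The features of \<open>S\<^sub>N\<close>, read as an operator on \<open>L\<^sup>2\<close>, that the growth estimate uses: it neither
  damps the constant mode nor mixes it with the others, and it is bounded on the span of the
  modes up to \<open>N\<close>.\<close>
definition smoother :: "nat \<Rightarrow> real \<Rightarrow> (L2 \<Rightarrow> L2) \<Rightarrow> bool" where
  "smoother N C s \<longleftrightarrow> linear s \<and> s (basis 0) = basis 0 \<and>
     (\<forall>v. inner (basis 0) (s v) = inner (basis 0) v) \<and>
     (\<forall>v. proj N v = v \<longrightarrow> proj N (s v) = s v \<and> norm (s v) \<le> C * norm v)"

lemma abs_poly_minus_leading_le:
  fixes y :: real
  assumes "1 \<le> \<bar>y\<bar>"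
  shows "\<bar>y\<bar> * \<bar>(\<Sum>k\<le>q. a k * y ^ k) - a q * y ^ q\<bar> \<le> (\<Sum>k<q. \<bar>a k\<bar>) * \<bar>y\<bar> ^ q"
proof -
  have "{..q} = insert q {..<q}" by auto
  then have "\<bar>y\<bar> * \<bar>(\<Sum>k\<le>q. a k * y ^ k) - a q * y ^ q\<bar> = \<bar>\<Sum>k<q. a k * y ^ Suc k\<bar>"
    by (simp add: abs_mult[symmetric] sum_distrib_left mult_ac)
  also have "\<dots> \<le> (\<Sum>k<q. \<bar>a k\<bar> * \<bar>y\<bar> ^ q)"
  proof (rule order_trans[OF sum_abs], rule sum_mono)
    fix k assume "k \<in> {..<q}"
    then have "\<bar>y\<bar> ^ Suc k \<le> \<bar>y\<bar> ^ q" using assms by (intro power_increasing) auto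
    then show "\<bar>a k * y ^ Suc k\<bar> \<le> \<bar>a k\<bar> * \<bar>y\<bar> ^ q"
      by (simp only: abs_mult power_abs mult_left_mono abs_ge_zero)
  qed
  finally show ?thesis by (simp add: sum_distrib_right)
qed

text \<open>One step of the scheme with noise \<open>w\<close>, for a state that is nearly constant. The term
  \<open>T / N * a\<^sub>q y\<^sup>q\<close> dominates \<open>y\<close>, the lower order terms, the noise and the contribution of
  \<open>z\<close>, because \<open>\<bar>y\<bar>\<close> is at least a multiple of \<open>N\<close> and \<open>z\<close> is relatively small; the
  part orthogonal to constants gains the factor \<open>\<bar>y\<bar> ^ (q - 1)\<close>, which is what \<open>\<bar>y\<bar>\<close> itself
  gains up to a multiple of \<open>N\<close>. So the relative error \<open>r\<close> is multiplied by \<open>O(N)\<close> only.\<close>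
lemma euler_step:
  fixes a :: "nat \<Rightarrow> real" and v w :: L2 and q N :: nat and s :: "L2 \<Rightarrow> L2" and T :: real
  defines "A \<equiv> \<Sum>k<q. \<bar>a k\<bar>" and "G \<equiv> \<Sum>k\<le>q. \<bar>a k\<bar> * real k * 2 ^ k"
    and "\<kappa> \<equiv> T * \<bar>a q\<bar> / 4"
  defines "v' \<equiv> s (v + (T / real N) *\<^sub>R proj N (nemytskii a q v) + w)"
  defines "y \<equiv> inner (basis 0) v" and "y' \<equiv> inner (basis 0) v'"
  assumes T: "0 < T" and q: "2 \<le> q" and aq: "a q \<noteq> 0" and N: "1 \<le> N"
    and s: "smoother N C s" and C: "0 \<le> C"
    and v: "proj N v = v" and w: "proj N w = w" "norm w \<le> \<rho>" "\<rho> \<le> 1" "\<rho> \<le> r"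
    and y1: "1 \<le> \<bar>y\<bar>" and y2: "real N * (T * A + 2) / \<kappa> \<le> \<bar>y\<bar>"
    and z: "norm (v - y *\<^sub>R basis 0) \<le> r * \<bar>y\<bar>"
    and r: "6 * real N * r \<le> 1" "6 * real N * r * G \<le> \<bar>a q\<bar> / 2"
  shows "proj N v' = v'"
    and "\<kappa> / real N * \<bar>y\<bar> ^ q \<le> \<bar>y'\<bar>"
    and "norm (v' - y' *\<^sub>R basis 0) \<le> C * (3 + 12 * T * G) / \<kappa> * real N * r * \<bar>y'\<bar>"
proof -
  define F where "F = nemytskii a q v"
  define f where "f = (\<Sum>k\<le>q. a k * y ^ k)"
  define D where "D = F - f *\<^sub>R basis 0"
  define z where "z = v - y *\<^sub>R basis 0"
  have lin: "linear s" and s0: "s (basis 0) = basis 0" and ins: "\<And>v. inner (basis 0) (s v) = inner (basis 0) v"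
    and sp: "\<And>v. proj N v = v \<Longrightarrow> proj N (s v) = s v" and sn: "\<And>v. proj N v = v \<Longrightarrow> norm (s v) \<le> C * norm v"
    using s by (auto simp: smoother_def)
  note lp = linear_add[OF linear_proj] linear_diff[OF linear_proj] linear_scale[OF linear_proj]
  note ls = linear_add[OF lin] linear_diff[OF lin] linear_scale[OF lin]
  have N0: "0 < real N" "1 \<le> real N" using N by auto
  have \<kappa>: "0 < \<kappa>" using T aq by (simp add: \<kappa>_def)
  have G: "0 \<le> G" unfolding G_def by (intro sum_nonneg) auto
  have A: "0 \<le> A" unfolding A_def by (intro sum_nonneg) auto
  have "0 \<le> norm w" by simp
  then have r0: "0 \<le> r" using w by linarith
  have zr: "norm z \<le> r * \<bar>y\<bar>" using z by (simp add: z_def)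
  have "6 * real N * norm z \<le> 6 * real N * (r * \<bar>y\<bar>)"
    using zr by (intro mult_left_mono) auto
  also have "\<dots> = (6 * real N * r) * \<bar>y\<bar>" by simp
  finally have z6: "6 * real N * norm z \<le> (6 * real N * r) * \<bar>y\<bar>" .
  also have "\<dots> \<le> 1 * \<bar>y\<bar>" using r by (intro mult_right_mono) auto
  finally have zy: "6 * real N * norm z \<le> \<bar>y\<bar>" by simp
  have D0: "\<bar>y\<bar> * norm D \<le> G * \<bar>y\<bar> ^ q * (6 * real N * norm z)"
    unfolding D_def F_def f_def G_def y_def z_def
    by (rule nemytskii_near_constant[OF N v]) (use y1 zy in \<open>auto simp: y_def z_def\<close>)
  have D1: "\<bar>y\<bar> * norm D \<le> \<bar>y\<bar> ^ q * (6 * real N * r * G) * \<bar>y\<bar>"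
  proof -
    have "G * \<bar>y\<bar> ^ q * (6 * real N * norm z) \<le> G * \<bar>y\<bar> ^ q * ((6 * real N * r) * \<bar>y\<bar>)"
      using G by (intro mult_left_mono[OF z6]) auto
    then show ?thesis using D0 by (simp add: mult_ac)
  qed
  have "\<bar>y\<bar> ^ q * (6 * real N * r * G) * \<bar>y\<bar> \<le> \<bar>y\<bar> ^ q * (\<bar>a q\<bar> / 2) * \<bar>y\<bar>"
    using r(2) by (intro mult_right_mono mult_left_mono) auto
  with D1 have D2: "\<bar>y\<bar> * norm D \<le> (\<bar>a q\<bar> / 2) * \<bar>y\<bar> ^ Suc q" by (simp add: mult_ac)
  show "proj N v' = v'"
    unfolding v'_def by (rule sp) (simp add: lp v w proj_proj)
  have y': "y' = y + (T / real N) * (f + inner (basis 0) D) + inner (basis 0) w"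
    unfolding y'_def v'_def ins F_def[symmetric]
    by (simp add: inner_right_distrib inner_basis_proj y_def D_def inner_diff_right inner_basis)
  \<comment> \<open>The leading term is split in half twice: one half absorbs \<open>D\<close>, half of the rest the lower order terms.\<close>
  have lower: "\<kappa> / real N * \<bar>y\<bar> ^ Suc q \<le> \<bar>y\<bar> * \<bar>y'\<bar>"
  proof -
    have e1: "\<bar>y\<bar> * \<bar>f - a q * y ^ q\<bar> \<le> A * \<bar>y\<bar> ^ q"
      unfolding f_def A_def by (rule abs_poly_minus_leading_le[OF y1])
    have e2: "\<bar>y\<bar> * \<bar>inner (basis 0) D\<bar> \<le> (\<bar>a q\<bar> / 2) * \<bar>y\<bar> ^ Suc q"
      by (rule order_trans[OF mult_left_mono D2]) (auto simp: abs_inner_basis_le)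
    have e3: "\<bar>y\<bar> * \<bar>y\<bar> \<le> \<bar>y\<bar> ^ q"
      using power_increasing[OF q y1] by (simp add: power2_eq_square)
    have "\<bar>inner (basis 0) w\<bar> \<le> \<bar>y\<bar>"
      using abs_inner_basis_le[of 0 w] w y1 by linarith
    then have e4: "\<bar>y\<bar> * \<bar>inner (basis 0) w\<bar> \<le> \<bar>y\<bar> ^ q"
      using e3 mult_left_mono[of "\<bar>inner (basis 0) w\<bar>" "\<bar>y\<bar>" "\<bar>y\<bar>"] by linarith
    have tri: "(T / real N) * \<bar>a q * y ^ q\<bar> \<le> \<bar>y'\<bar> + \<bar>y\<bar> + (T / real N) * (\<bar>f - a q * y ^ q\<bar> + \<bar>inner (basis 0) D\<bar>) + \<bar>inner (basis 0) w\<bar>"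
    proof -
      have "(T / real N) * (a q * y ^ q) = y' - y - (T / real N) * ((f - a q * y ^ q) + inner (basis 0) D) - inner (basis 0) w"
        unfolding y' by (simp add: algebra_simps)
      then have "\<bar>(T / real N) * (a q * y ^ q)\<bar> \<le> \<bar>y'\<bar> + \<bar>y\<bar> + \<bar>(T / real N) * ((f - a q * y ^ q) + inner (basis 0) D)\<bar> + \<bar>inner (basis 0) w\<bar>"
        by linarith
      also have "\<bar>(T / real N) * ((f - a q * y ^ q) + inner (basis 0) D)\<bar> \<le> (T / real N) * (\<bar>f - a q * y ^ q\<bar> + \<bar>inner (basis 0) D\<bar>)"
        unfolding abs_mult using T by (intro mult_mono abs_triangle_ineq) auto
      finally show ?thesis using T by (simp add: abs_mult)
    qed
    have "\<bar>y\<bar> * ((T / real N) * \<bar>a q * y ^ q\<bar>) \<le> \<bar>y\<bar> * (\<bar>y'\<bar> + \<bar>y\<bar> + (T / real N) * (\<bar>f - a q * y ^ q\<bar> + \<bar>inner (basis 0) D\<bar>) + \<bar>inner (basis 0) w\<bar>)"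
      by (rule mult_left_mono[OF tri]) simp
    also have "\<dots> = \<bar>y\<bar> * \<bar>y'\<bar> + \<bar>y\<bar> * \<bar>y\<bar> + (T / real N) * (\<bar>y\<bar> * \<bar>f - a q * y ^ q\<bar> + \<bar>y\<bar> * \<bar>inner (basis 0) D\<bar>) + \<bar>y\<bar> * \<bar>inner (basis 0) w\<bar>"
      by (simp only: distrib_left mult_ac)
    also have "\<dots> \<le> \<bar>y\<bar> * \<bar>y'\<bar> + \<bar>y\<bar> ^ q + (T / real N) * (A * \<bar>y\<bar> ^ q + (\<bar>a q\<bar> / 2) * \<bar>y\<bar> ^ Suc q) + \<bar>y\<bar> ^ q"
      using T by (intro add_mono mult_left_mono e1 e2 e3 e4) auto
    finally have "(T / real N) * (\<bar>a q\<bar> / 2) * \<bar>y\<bar> ^ Suc q \<le> \<bar>y\<bar> * \<bar>y'\<bar> + 2 * \<bar>y\<bar> ^ q + (T / real N) * A * \<bar>y\<bar> ^ q"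
      by (simp add: abs_mult power_abs algebra_simps)
    moreover have "(T / real N) * A * \<bar>y\<bar> ^ q \<le> T * A * \<bar>y\<bar> ^ q"
      using T A N0 by (intro mult_right_mono) (auto simp: divide_le_eq mult_le_cancel_left1)
    moreover have "(T * A + 2) * \<bar>y\<bar> ^ q \<le> \<kappa> / real N * \<bar>y\<bar> * \<bar>y\<bar> ^ q"
      using y2 \<kappa> N0 by (intro mult_right_mono) (auto simp: field_simps)
    moreover have "(T / real N) * (\<bar>a q\<bar> / 2) * \<bar>y\<bar> ^ Suc q = 2 * (\<kappa> / real N * \<bar>y\<bar> ^ Suc q)"
      by (simp add: \<kappa>_def mult_ac)
    moreover have "\<kappa> / real N * \<bar>y\<bar> * \<bar>y\<bar> ^ q = \<kappa> / real N * \<bar>y\<bar> ^ Suc q" by simp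
    ultimately show ?thesis by (simp only: distrib_right)
  qed
  then have "\<bar>y\<bar> * (\<kappa> / real N * \<bar>y\<bar> ^ q) \<le> \<bar>y\<bar> * \<bar>y'\<bar>" by (simp add: mult_ac)
  then show "\<kappa> / real N * \<bar>y\<bar> ^ q \<le> \<bar>y'\<bar>" using y1 by (subst (asm) mult_le_cancel_left_pos) auto
  \<comment> \<open>Constants pass through \<open>s\<close> unchanged, so the orthogonal part evolves by itself, driven by \<open>D\<close>.\<close>
  have "v' - y' *\<^sub>R basis 0 = v' - y' *\<^sub>R s (basis 0)" by (simp add: s0)
  also have "\<dots> = s (v + (T / real N) *\<^sub>R proj N F + w - y' *\<^sub>R basis 0)"
    by (simp add: v'_def F_def ls)
  also have "v + (T / real N) *\<^sub>R proj N F + w - y' *\<^sub>R basis 0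
      = z + (T / real N) *\<^sub>R (proj N D - inner (basis 0) D *\<^sub>R basis 0) + (w - inner (basis 0) w *\<^sub>R basis 0)"
    by (simp add: y' z_def D_def lp proj_basis algebra_simps)
  finally have z': "v' - y' *\<^sub>R basis 0 = s (z + (T / real N) *\<^sub>R (proj N D - inner (basis 0) D *\<^sub>R basis 0) + (w - inner (basis 0) w *\<^sub>R basis 0))"
    (is "_ = s ?u") .
  have pu: "proj N ?u = ?u" by (simp add: z_def lp v w proj_proj proj_basis)
  have two: "norm (u - inner (basis 0) u' *\<^sub>R basis 0) \<le> 2 * norm u'" if "norm u \<le> norm u'" for u u'
  proof -
    have "norm (u - inner (basis 0) u' *\<^sub>R basis 0) \<le> norm u + \<bar>inner (basis 0) u'\<bar>"
      using norm_triangle_ineq4[of u "inner (basis 0) u' *\<^sub>R basis 0"] by simp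
    then show ?thesis using that abs_inner_basis_le[of 0 u'] by linarith
  qed
  have "norm ?u \<le> norm z + (T / real N) * (2 * norm D) + 2 * norm w"
  proof -
    have "norm ?u \<le> norm z + norm ((T / real N) *\<^sub>R (proj N D - inner (basis 0) D *\<^sub>R basis 0)) + norm (w - inner (basis 0) w *\<^sub>R basis 0)"
      by (intro order_trans[OF norm_triangle_ineq] add_right_mono norm_triangle_ineq)
    also have "norm ((T / real N) *\<^sub>R (proj N D - inner (basis 0) D *\<^sub>R basis 0)) \<le> (T / real N) * (2 * norm D)"
      unfolding norm_scaleR using T two[OF norm_proj_le] by (simp add: mult_left_mono divide_right_mono)
    finally show ?thesis using two[OF order_refl, of w] by linarith
  qed
  then have nz': "norm (v' - y' *\<^sub>R basis 0) \<le> C * (norm z + (T / real N) * (2 * norm D) + 2 * norm w)"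
    unfolding z' using sn[OF pu] C by (meson mult_left_mono order_trans)
  have "\<bar>y\<bar> * norm (v' - y' *\<^sub>R basis 0) \<le> C * (\<bar>y\<bar> * norm z + (T / real N) * (2 * (\<bar>y\<bar> * norm D)) + 2 * (\<bar>y\<bar> * norm w))"
    using mult_left_mono[OF nz', of "\<bar>y\<bar>"] by (simp add: algebra_simps)
  also have "\<dots> \<le> C * (r * \<bar>y\<bar> ^ Suc q + 12 * T * G * r * \<bar>y\<bar> ^ Suc q + 2 * (r * \<bar>y\<bar> ^ Suc q))"
  proof (intro mult_left_mono[OF _ C] add_mono)
    have ys: "\<bar>y\<bar> * \<bar>y\<bar> \<le> \<bar>y\<bar> ^ Suc q" "\<bar>y\<bar> \<le> \<bar>y\<bar> ^ Suc q"
      using power_increasing[OF _ y1, of 2 "Suc q"] power_increasing[OF _ y1, of 1 "Suc q"] q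
      by (auto simp: power2_eq_square)
    have "\<bar>y\<bar> * norm z \<le> \<bar>y\<bar> * (r * \<bar>y\<bar>)" using zr by (intro mult_left_mono) auto
    also have "\<dots> = r * (\<bar>y\<bar> * \<bar>y\<bar>)" by simp
    also have "\<dots> \<le> r * \<bar>y\<bar> ^ Suc q" using ys r0 by (intro mult_left_mono) auto
    finally show "\<bar>y\<bar> * norm z \<le> r * \<bar>y\<bar> ^ Suc q" .
    have "(T / real N) * (2 * (\<bar>y\<bar> * norm D)) \<le> (T / real N) * (2 * (\<bar>y\<bar> ^ q * (6 * real N * r * G) * \<bar>y\<bar>))"
      using D1 T by (intro mult_left_mono) auto
    also have "\<dots> = 12 * T * G * r * \<bar>y\<bar> ^ Suc q" using N0 by (simp add: field_simps)
    finally show "(T / real N) * (2 * (\<bar>y\<bar> * norm D)) \<le> 12 * T * G * r * \<bar>y\<bar> ^ Suc q" .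
    have "\<bar>y\<bar> * norm w \<le> \<bar>y\<bar> ^ Suc q * r" using ys w r0 by (intro mult_mono) auto
    then show "2 * (\<bar>y\<bar> * norm w) \<le> 2 * (r * \<bar>y\<bar> ^ Suc q)" by (simp add: mult_ac)
  qed
  also have "\<dots> = C * (3 + 12 * T * G) * r * \<bar>y\<bar> ^ Suc q" by (simp add: algebra_simps)
  also have "\<bar>y\<bar> ^ Suc q \<le> real N / \<kappa> * (\<bar>y\<bar> * \<bar>y'\<bar>)"
    using lower \<kappa> N0 by (simp add: field_simps)
  then have "C * (3 + 12 * T * G) * r * \<bar>y\<bar> ^ Suc q \<le> C * (3 + 12 * T * G) * r * (real N / \<kappa> * (\<bar>y\<bar> * \<bar>y'\<bar>))"
    using C T G r0 by (intro mult_left_mono) auto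
  finally have "\<bar>y\<bar> * norm (v' - y' *\<^sub>R basis 0) \<le> \<bar>y\<bar> * (C * (3 + 12 * T * G) / \<kappa> * real N * r * \<bar>y'\<bar>)"
    by (simp add: mult_ac)
  then show "norm (v' - y' *\<^sub>R basis 0) \<le> C * (3 + 12 * T * G) / \<kappa> * real N * r * \<bar>y'\<bar>"
    using y1 by (subst (asm) mult_le_cancel_left_pos) auto
qed


text \<open>Iteration of \<open>euler_step\<close>. The relative error after \<open>n\<close> steps is at most
  \<open>\<rho> (\<Theta> N)\<^sup>n\<close>, and the bound on \<open>\<rho>\<close> keeps it below \<open>\<epsilon> / N\<close> up to time \<open>N\<close>. The quotient
  \<open>\<bar>y\<^sub>n\<bar> / (\<Lambda> N)\<close> is at least 2 for \<open>n = 1\<close> and is at least squared in every step.\<close>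
lemma euler_blow_up:
  fixes a :: "nat \<Rightarrow> real" and q :: nat and T C :: real
  assumes T: "0 < T" and q: "2 \<le> q" and aq: "a q \<noteq> 0" and C: "0 \<le> C"
  obtains \<Lambda> \<Theta> \<epsilon> where "1 \<le> \<Lambda>" and "1 \<le> \<Theta>" and "0 < \<epsilon>" and "\<epsilon> \<le> 1"
    and "\<And>N s Y w \<rho>. \<lbrakk>1 \<le> N; smoother N C s;
      Y 1 = s ((2 * \<Lambda> * real N + 1) *\<^sub>R basis 0 + w 0);
      \<And>n. n \<in> {1..<N} \<Longrightarrow>
        Y (Suc n) = s (Y n + (T / real N) *\<^sub>R proj N (nemytskii a q (Y n)) + w n);
      \<And>n. n < N \<Longrightarrow> proj N (w n) = w n; \<And>n. n < N \<Longrightarrow> norm (w n) \<le> \<rho>;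
      \<rho> \<le> \<epsilon> / (real N * (\<Theta> * real N) ^ N)\<rbrakk> \<Longrightarrow> 2 ^ 2 ^ (N - 1) \<le> norm (Y N)"
proof -
  define A where "A = (\<Sum>k<q. \<bar>a k\<bar>)"
  define G where "G = (\<Sum>k\<le>q. \<bar>a k\<bar> * real k * 2 ^ k)"
  define \<kappa> where "\<kappa> = T * \<bar>a q\<bar> / 4"
  \<comment> \<open>\<open>\<Lambda> N\<close> is large enough for \<open>euler_step\<close> and for \<open>\<bar>y\<^bsub>n+1\<^esub>\<bar> \<ge> \<bar>y\<^sub>n\<bar>\<^sup>2 / (\<Lambda> N)\<close>; the summand \<open>2 * C\<close> of \<open>\<Theta>\<close> serves the first step.\<close>
  define \<Lambda> where "\<Lambda> = 1 + 1 / \<kappa> + (T * A + 2) / \<kappa>"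
  define \<Theta> where "\<Theta> = 1 + 2 * C + C * (3 + 12 * T * G) / \<kappa>"
  define \<epsilon> where "\<epsilon> = min (1 / 6) (\<bar>a q\<bar> / (12 * (G + 1)))"
  have \<kappa>: "0 < \<kappa>" using T aq by (simp add: \<kappa>_def)
  have G: "0 \<le> G" unfolding G_def by (intro sum_nonneg) auto
  have A: "0 \<le> A" unfolding A_def by (intro sum_nonneg) auto
  have "0 \<le> 1 / \<kappa>" "0 \<le> (T * A + 2) / \<kappa>" using \<kappa> T A by auto
  then have \<Lambda>: "1 \<le> \<Lambda>" "1 / \<kappa> \<le> \<Lambda>" "(T * A + 2) / \<kappa> \<le> \<Lambda>" unfolding \<Lambda>_def by linarith+
  have "0 \<le> C * (3 + 12 * T * G) / \<kappa>" using \<kappa> T G C by auto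
  then have \<Theta>: "1 \<le> \<Theta>" "2 * C \<le> \<Theta>" "C * (3 + 12 * T * G) / \<kappa> \<le> \<Theta>" using C unfolding \<Theta>_def by linarith+
  have \<epsilon>: "0 < \<epsilon>" "\<epsilon> \<le> 1" "6 * \<epsilon> \<le> 1" "6 * \<epsilon> * G \<le> \<bar>a q\<bar> / 2"
  proof -
    show "0 < \<epsilon>" "\<epsilon> \<le> 1" "6 * \<epsilon> \<le> 1" using aq G by (auto simp: \<epsilon>_def)
    have "6 * \<epsilon> * G \<le> 6 * \<epsilon> * (G + 1)" using \<open>0 < \<epsilon>\<close> by (intro mult_left_mono) auto
    also have "\<dots> \<le> 6 * (\<bar>a q\<bar> / (12 * (G + 1))) * (G + 1)"
      using G by (intro mult_right_mono) (auto simp: \<epsilon>_def)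
    also have "\<dots> = \<bar>a q\<bar> / 2" using G by (simp add: field_simps)
    finally show "6 * \<epsilon> * G \<le> \<bar>a q\<bar> / 2" .
  qed
  have main: "2 ^ 2 ^ (N - 1) \<le> norm (Y N)"
    if N: "1 \<le> N" and s: "smoother N C s"
      and Y1: "Y 1 = s ((2 * \<Lambda> * real N + 1) *\<^sub>R basis 0 + w 0)"
      and YS: "\<And>n. n \<in> {1..<N} \<Longrightarrow> Y (Suc n) = s (Y n + (T / real N) *\<^sub>R proj N (nemytskii a q (Y n)) + w n)"
      and w: "\<And>n. n < N \<Longrightarrow> proj N (w n) = w n" "\<And>n. n < N \<Longrightarrow> norm (w n) \<le> \<rho>"
      and \<rho>: "\<rho> \<le> \<epsilon> / (real N * (\<Theta> * real N) ^ N)" for N s Y w \<rho>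
  proof -
    have N1: "1 \<le> real N" using N by simp
    have \<Theta>N: "1 \<le> \<Theta> * real N" using \<Theta>(1) N1 mult_mono[of 1 \<Theta> 1 "real N"] by simp
    have \<Lambda>N: "1 \<le> \<Lambda> * real N" using \<Lambda>(1) N1 mult_mono[of 1 \<Lambda> 1 "real N"] by simp
    have \<rho>0: "0 \<le> \<rho>" using w(2)[of 0] N norm_ge_zero[of "w 0"] by linarith
    define r where "r n = \<rho> * (\<Theta> * real N) ^ n" for n
    have r: "6 * real N * r n \<le> 6 * \<epsilon>" if "n \<le> N" for n
    proof -
      have "real N * r n \<le> real N * (\<rho> * (\<Theta> * real N) ^ N)"
        unfolding r_def using \<rho>0 \<Theta>N that by (intro mult_left_mono power_increasing) auto
      also have "\<dots> \<le> \<epsilon>" using \<rho> N1 \<Theta>(1) by (simp add: pos_le_divide_eq mult_ac)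
      finally show ?thesis by simp
    qed
    have \<rho>r: "\<rho> \<le> r n" for n
      unfolding r_def using mult_left_mono[OF one_le_power[OF \<Theta>N, of n] \<rho>0] by simp
    have \<rho>1: "\<rho> \<le> 1"
    proof -
      have "6 * real N * r 0 \<le> 1" using r[of 0] \<epsilon>(3) by linarith
      moreover have "1 * \<rho> \<le> (6 * real N) * \<rho>" using N1 \<rho>0 by (intro mult_right_mono) auto
      ultimately show ?thesis by (simp add: r_def)
    qed
    have lin: "linear s" and s0: "s (basis 0) = basis 0"
      and ins: "\<And>v. inner (basis 0) (s v) = inner (basis 0) v"
      and sp: "\<And>v. proj N v = v \<Longrightarrow> proj N (s v) = s v"
      and sn: "\<And>v. proj N v = v \<Longrightarrow> norm (s v) \<le> C * norm v"
      using s by (auto simp: smoother_def)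
    note lp = linear_add[OF linear_proj] linear_diff[OF linear_proj] linear_scale[OF linear_proj]
    have "proj N (Y n) = Y n \<and>
        \<Lambda> * real N * 2 ^ 2 ^ (n - 1) \<le> \<bar>inner (basis 0) (Y n)\<bar> \<and>
        norm (Y n - inner (basis 0) (Y n) *\<^sub>R basis 0) \<le> r n * \<bar>inner (basis 0) (Y n)\<bar>"
      if "1 \<le> n" "n \<le> N" for n
      using that
    proof (induction n rule: dec_induct)
      case base
      let ?y = "inner (basis 0) (Y 1)"
      have w0: "proj N (w 0) = w 0" "norm (w 0) \<le> \<rho>" using w N by auto
      have y: "?y = 2 * \<Lambda> * real N + 1 + inner (basis 0) (w 0)"
        unfolding Y1 ins by (simp add: inner_right_distrib inner_basis)
      moreover have "\<bar>inner (basis 0) (w 0)\<bar> \<le> 1"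
        using abs_inner_basis_le[of 0 "w 0"] w0 \<rho>1 by linarith
      ultimately have y2: "2 * \<Lambda> * real N \<le> ?y" by linarith
      then have y1: "1 \<le> \<bar>?y\<bar>" using \<Lambda>N by linarith
      have p: "proj N (Y 1) = Y 1"
        unfolding Y1 by (intro sp) (simp add: lp w0 proj_basis)
      have "Y 1 - ?y *\<^sub>R basis 0 = Y 1 - ?y *\<^sub>R s (basis 0)" by (simp add: s0)
      also have "\<dots> = s (w 0 - inner (basis 0) (w 0) *\<^sub>R basis 0)"
        unfolding y unfolding Y1
        by (simp add: linear_add[OF lin] linear_diff[OF lin] linear_scale[OF lin] algebra_simps)
      also have "norm \<dots> \<le> C * norm (w 0 - inner (basis 0) (w 0) *\<^sub>R basis 0)"
        by (rule sn) (simp add: lp w0 proj_basis)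
      also have "\<dots> \<le> C * (2 * \<rho>)"
      proof (intro mult_left_mono C)
        show "norm (w 0 - inner (basis 0) (w 0) *\<^sub>R basis 0) \<le> 2 * \<rho>"
          using norm_triangle_ineq4[of "w 0" "inner (basis 0) (w 0) *\<^sub>R basis 0"]
            abs_inner_basis_le[of 0 "w 0"] w0 by simp
      qed
      also have "\<dots> = (2 * C) * \<rho> * 1" by simp
      also have "\<dots> \<le> (\<Theta> * real N) * \<rho> * \<bar>?y\<bar>"
      proof (rule mult_mono[OF mult_right_mono y1])
        have "2 * C * 1 \<le> \<Theta> * real N" using \<Theta> N1 C by (intro mult_mono) auto
        then show "2 * C \<le> \<Theta> * real N" by simp
      qed (use \<Theta>N \<rho>0 in auto)
      finally show ?case using p y2 by (simp add: r_def mult_ac)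
    next
      case (step n)
      let ?y = "inner (basis 0) (Y n)" and ?y' = "inner (basis 0) (Y (Suc n))"
      have IH: "proj N (Y n) = Y n" "\<Lambda> * real N * 2 ^ 2 ^ (n - 1) \<le> \<bar>?y\<bar>"
          "norm (Y n - ?y *\<^sub>R basis 0) \<le> r n * \<bar>?y\<bar>"
        using step by auto
      have n: "n < N" using step by auto
      have p1: "(1::real) \<le> 2 ^ 2 ^ (n - 1)" by simp
      have y\<Lambda>: "\<Lambda> * real N \<le> \<bar>?y\<bar>"
        using mult_left_mono[OF p1, of "\<Lambda> * real N"] \<Lambda>N IH(2) by linarith
      then have y1: "1 \<le> \<bar>?y\<bar>" using \<Lambda>N by linarith
      have "(T * A + 2) / \<kappa> * real N \<le> \<Lambda> * real N" using \<Lambda>(3) by (intro mult_right_mono) auto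
      then have y2: "real N * (T * A + 2) / \<kappa> \<le> \<bar>?y\<bar>" using y\<Lambda> by (simp add: mult.commute)
      have r1: "6 * real N * r n \<le> 1" using r[of n] n \<epsilon>(3) by simp
      have "6 * real N * r n * G \<le> 6 * \<epsilon> * G" using r[of n] n G by (intro mult_right_mono) auto
      then have r2: "6 * real N * r n * G \<le> \<bar>a q\<bar> / 2" using \<epsilon>(4) by linarith
      have Yn: "Y (Suc n) = s (Y n + (T / real N) *\<^sub>R proj N (nemytskii a q (Y n)) + w n)"
        using step by (intro YS) auto
      have es: "proj N (Y (Suc n)) = Y (Suc n)" "\<kappa> / real N * \<bar>?y\<bar> ^ q \<le> \<bar>?y'\<bar>"
        "norm (Y (Suc n) - ?y' *\<^sub>R basis 0) \<le> C * (3 + 12 * T * G) / \<kappa> * real N * r n * \<bar>?y'\<bar>"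
        using euler_step[OF T q aq N s C IH(1) w(1)[OF n] w(2)[OF n] \<rho>1 \<rho>r[of n] y1
            y2[unfolded A_def \<kappa>_def] IH(3) r1 r2[unfolded G_def]]
        unfolding Yn[symmetric] A_def G_def \<kappa>_def by blast+
      have "C * (3 + 12 * T * G) / \<kappa> * real N * r n * \<bar>?y'\<bar> \<le> \<Theta> * real N * r n * \<bar>?y'\<bar>"
        using \<Theta>(3) \<rho>0 \<rho>r[of n] by (intro mult_right_mono) auto
      also have "\<dots> = r (Suc n) * \<bar>?y'\<bar>" by (simp add: r_def)
      finally have z: "norm (Y (Suc n) - ?y' *\<^sub>R basis 0) \<le> r (Suc n) * \<bar>?y'\<bar>" using es(3) by linarith
      have exp: "(2::real) ^ 2 ^ (Suc n - 1) = (2 ^ 2 ^ (n - 1))\<^sup>2"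
      proof -
        obtain m where "n = Suc m" using step(1) by (cases n) auto
        then show ?thesis by (simp flip: power_mult)
      qed
      have "\<Lambda> * real N * 2 ^ 2 ^ (Suc n - 1) = (\<Lambda> * real N * 2 ^ 2 ^ (n - 1))\<^sup>2 / (\<Lambda> * real N)"
        unfolding exp using \<Lambda>N by (simp add: power2_eq_square)
      also have "\<dots> \<le> \<bar>?y\<bar>\<^sup>2 / (\<Lambda> * real N)"
        using IH(2) \<Lambda>N by (intro divide_right_mono power_mono) auto
      also have "\<dots> \<le> \<bar>?y\<bar> ^ q / (\<Lambda> * real N)"
        using y1 q \<Lambda>N by (intro divide_right_mono power_increasing) auto
      also have "\<dots> \<le> \<bar>?y\<bar> ^ q / (1 / \<kappa> * real N)"
        using \<Lambda>(2) \<kappa> N1 \<Lambda>N by (intro divide_left_mono mult_right_mono) auto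
      also have "\<dots> = \<kappa> / real N * \<bar>?y\<bar> ^ q" by simp
      finally show ?case using es(1,2) z by linarith
    qed
    from this[of N] N have "\<Lambda> * real N * 2 ^ 2 ^ (N - 1) \<le> \<bar>inner (basis 0) (Y N)\<bar>" by auto
    moreover have "1 * 2 ^ 2 ^ (N - 1) \<le> \<Lambda> * real N * 2 ^ 2 ^ (N - 1)"
      using \<Lambda>N by (intro mult_right_mono) auto
    ultimately show ?thesis using abs_inner_basis_le[of 0 "Y N"] by linarith
  qed
  show thesis
    by (rule that[OF \<Lambda>(1) \<Theta>(1) \<epsilon>(1,2)]) (rule main)
qed

section \<open>Interpolation spaces and the noise in Fourier modes\<close>

lemma inner_product_on_minus:
  assumes "inner_product_on V g" "u \<in> V" "v \<in> V"
  shows "u - v \<in> V"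
  using assms by (auto simp: inner_product_on_def subspace_diff)

text \<open>The operators of the scheme for one fixed \<open>N\<close>. Here \<open>L\<close> stands for \<open>\<eta> - A\<close>, which enters through
  its interpolation spaces.\<close>
locale smoothed_galerkin =
  fixes L :: "L2 \<Rightarrow> L2" and J :: "L2 \<Rightarrow> 'v::real_vector"
    and H :: "real \<Rightarrow> 'v set" and ip :: "real \<Rightarrow> 'v \<Rightarrow> 'v \<Rightarrow> real"
    and P S :: "'v \<Rightarrow> 'v" and N :: nat and \<nu> C :: real
  assumes interp: "interpolation_spaces basis L J H ip"
    and \<nu>: "0 < \<nu>" "\<nu> \<le> 1"
    and P_J: "P (J v) = J (proj N v)"
    and S_bdd: "bounded_linear_between (H (-\<nu>)) (ip (-\<nu>)) (H (-\<nu>)) (ip (-\<nu>)) S"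
    and S_smooth: "S ` H (-\<nu>) \<subseteq> H (-\<nu> + 1)"
    and S_norm: "norm w \<le> 1 \<Longrightarrow> ip_norm (ip 0) (S (J w)) \<le> C"
    and S_e0: "S (J (basis 0)) = J (basis 0)"
    and S_sym: "inner (inv J (S (J u))) v = inner u (inv J (S (J v)))"
    and S_P: "P (S (J v)) = S (P (J v))"
begin

lemma J_linear: "linear J" and J_inj: "inj J"
  using interp by (auto simp: interpolation_spaces_def)

lemmas J_simps = linear_add[OF J_linear] linear_diff[OF J_linear] linear_scale[OF J_linear]
  linear_sum[OF J_linear] linear_0[OF J_linear]

lemma J_eq_iff: "J u = J v \<longleftrightarrow> u = v"
  using J_inj by (simp add: inj_eq)

lemma ip_space: "inner_product_on (H (-\<nu>)) (ip (-\<nu>))"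
  and J_in_H: "J v \<in> H (-\<nu>)"
  and ip_J: "ip (-\<nu>) (J v) (J w) = inner (fpow basis L (-\<nu>) v) (fpow basis L (-\<nu>) w)"
proof -
  have "-\<nu> < 0" using \<nu>(1) by simp
  then have *: "inner_product_on (H (-\<nu>)) (ip (-\<nu>))" "range J \<subseteq> H (-\<nu>)"
    "\<forall>v w. ip (-\<nu>) (J v) (J w) = inner (fpow basis L (-\<nu>) v) (fpow basis L (-\<nu>) w)"
    using interp unfolding interpolation_spaces_def by blast+
  show "inner_product_on (H (-\<nu>)) (ip (-\<nu>))" by (rule *)
  show "J v \<in> H (-\<nu>)" using *(2) by blast
  show "ip (-\<nu>) (J v) (J w) = inner (fpow basis L (-\<nu>) v) (fpow basis L (-\<nu>) w)" using *(3) by blast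
qed

lemma metric: "Metric_space (H (-\<nu>)) (ip_dist (H (-\<nu>)) (ip (-\<nu>)))"
  using ip_space by (rule Metric_space_ip_dist)

lemma fpow_nonzero: "v \<noteq> 0 \<Longrightarrow> fpow basis L (-\<nu>) v \<noteq> 0"
proof
  assume v: "v \<noteq> 0" "fpow basis L (-\<nu>) v = 0"
  then have "ip (-\<nu>) (J v) (J v) = 0" by (simp add: ip_J)
  then have "J v = 0" using ip_space J_in_H by (auto simp: inner_product_on_def)
  then show False using v J_eq_iff[of v 0] by (simp add: J_simps)
qed

text \<open>An infinite sum that does not converge has the value 0 by convention. For \<open>v \<noteq> 0\<close> this value is
  excluded by the definiteness of the inner product of \<open>H\<^bsub>-\<nu>\<^esub>\<close>, so the series converges.\<close>
lemma fpow_has_sum: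
  "((\<lambda>n. (eigenvalue basis L n powr (-\<nu>) * inner (basis n) v) *\<^sub>R basis n) has_sum fpow basis L (-\<nu>) v) UNIV"
proof (cases "v = 0")
  case True
  then show ?thesis by (simp add: fpow_def)
next
  case False
  then have "(\<lambda>n. (eigenvalue basis L n powr (-\<nu>) * inner (basis n) v) *\<^sub>R basis n) summable_on UNIV"
    using fpow_nonzero infsum_not_exists unfolding fpow_def by blast
  then show ?thesis unfolding fpow_def by (rule has_sum_infsum)
qed

lemma inner_basis_fpow:
  "inner (basis m) (fpow basis L (-\<nu>) v) = eigenvalue basis L m powr (-\<nu>) * inner (basis m) v"
proof -
  let ?c = "\<lambda>n. eigenvalue basis L n powr (-\<nu>) * inner (basis n) v"
  have "((\<lambda>n. inner (basis m) (?c n *\<^sub>R basis n)) has_sum inner (basis m) (fpow basis L (-\<nu>) v)) UNIV"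
    by (rule has_sum_bounded_linear[OF bounded_linear_inner_right fpow_has_sum])
  moreover have "((\<lambda>n. inner (basis m) (?c n *\<^sub>R basis n)) has_sum ?c m) UNIV"
    by (rule has_sum_finite_neutralI[of "{m}"]) (auto simp: inner_basis)
  ultimately show ?thesis by (rule has_sum_unique)
qed

text \<open>Definiteness again: since \<open>0 powr (- \<nu>) = 0\<close>, a vanishing eigenvalue would give the basis vector
  the norm 0 in \<open>H\<^bsub>-\<nu>\<^esub>\<close>.\<close>
lemma eigenvalue_powr_pos: "0 < eigenvalue basis L m powr (-\<nu>)"
proof -
  have "fpow basis L (-\<nu>) (basis m) = eigenvalue basis L m powr (-\<nu>) *\<^sub>R basis m"
  proof -
    have "((\<lambda>n. (eigenvalue basis L n powr (-\<nu>) * inner (basis n) (basis m)) *\<^sub>R basis n)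
        has_sum eigenvalue basis L m powr (-\<nu>) *\<^sub>R basis m) UNIV"
      by (rule has_sum_finite_neutralI[of "{m}"]) (auto simp: inner_basis)
    then show ?thesis using fpow_has_sum has_sum_unique by blast
  qed
  moreover have "basis m \<noteq> 0" using norm_basis[of m] by fastforce
  ultimately have "eigenvalue basis L m powr (-\<nu>) \<noteq> 0" using fpow_nonzero by fastforce
  then show ?thesis by (simp add: less_le)
qed

text \<open>Continuity of the Fourier coefficients with respect to the norm of \<open>H\<^bsub>-\<nu>\<^esub>\<close>.\<close>
lemma coefficient_le_ip_norm:
  "eigenvalue basis L m powr (-\<nu>) * \<bar>inner (basis m) v\<bar> \<le> ip_norm (ip (-\<nu>)) (J v)"
proof -
  have "eigenvalue basis L m powr (-\<nu>) * \<bar>inner (basis m) v\<bar> = \<bar>inner (basis m) (fpow basis L (-\<nu>) v)\<bar>"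
    by (simp add: inner_basis_fpow abs_mult)
  also have "\<dots> \<le> norm (fpow basis L (-\<nu>) v)" by (rule abs_inner_basis_le)
  finally show ?thesis by (simp add: ip_norm_def ip_J norm_eq_sqrt_inner)
qed

text \<open>On the span of finitely many modes the series defining the power of exponent 0 is a finite sum,
  so there the norm of \<open>H\<^sub>0\<close> is the \<open>L\<^sup>2\<close> norm.\<close>
lemma ip_norm_0_J:
  assumes v: "proj N v = v"
  shows "ip_norm (ip 0) (J v) = norm v"
proof -
  have v0: "inner (basis n) v = 0" if "n \<notin> {- int N..int N}" for n
    using inner_basis_proj[of n N v] v that by auto
  have ev: "eigenvalue basis L n \<noteq> 0" for n using eigenvalue_powr_pos[of n] by auto
  have "(\<lambda>n. \<bar>eigenvalue basis L n powr 0 * inner (basis n) v\<bar>\<^sup>2) summable_on UNIV"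
    by (rule has_sum_imp_summable[OF has_sum_finite_neutralI[of "{- int N..int N}"]]) (auto simp: v0)
  then have dom: "v \<in> fpow_dom basis L 0" by (simp add: fpow_dom_def)
  have "((\<lambda>n. (eigenvalue basis L n powr 0 * inner (basis n) v) *\<^sub>R basis n) has_sum proj N v) UNIV"
    unfolding proj_def
    by (rule has_sum_finite_neutralI[of "{- int N..int N}"]) (auto simp: v0 ev)
  then have "fpow basis L 0 v = v" unfolding fpow_def v by (rule infsumI)
  moreover have "ip 0 (J v) (J v) = inner (fpow basis L 0 v) (fpow basis L 0 v)"
    using interp dom by (auto simp: interpolation_spaces_def)
  ultimately show ?thesis by (simp add: ip_norm_def norm_eq_sqrt_inner)
qed

text \<open>The restriction of \<open>S\<close> to \<open>L\<^sup>2\<close>. The inverse of the embedding is legitimate since \<open>S\<close> gains one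
  degree of regularity and \<open>\<nu> \<le> 1\<close>.\<close>
definition smooth :: "L2 \<Rightarrow> L2" where "smooth v = inv J (S (J v))"

lemma S_range:
  assumes "h \<in> H (-\<nu>)"
  shows "J (inv J (S h)) = S h"
proof -
  have "H (-\<nu> + 1) \<subseteq> range J" using interp \<nu> by (auto simp: interpolation_spaces_def)
  then have "S h \<in> range J" using assms S_smooth by blast
  then show ?thesis by (rule f_inv_into_f)
qed

lemma J_smooth: "J (smooth v) = S (J v)"
  unfolding smooth_def by (rule S_range[OF J_in_H])

lemma S_add: "u \<in> H (-\<nu>) \<Longrightarrow> v \<in> H (-\<nu>) \<Longrightarrow> S (u + v) = S u + S v"
  and S_scale: "v \<in> H (-\<nu>) \<Longrightarrow> S (c *\<^sub>R v) = c *\<^sub>R S v"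
  using S_bdd by (auto simp: bounded_linear_between_def)

lemma S_diff:
  assumes "u \<in> H (-\<nu>)" "v \<in> H (-\<nu>)"
  shows "S (u - v) = S u - S v"
proof -
  have "u - v \<in> H (-\<nu>)" using ip_space assms by (rule inner_product_on_minus)
  from S_add[OF this assms(2)] show ?thesis by (simp add: algebra_simps)
qed

lemma linear_smooth: "linear smooth"
proof (rule linearI)
  show "smooth (u + v) = smooth u + smooth v" for u v
    by (subst J_eq_iff[symmetric]) (simp add: J_smooth J_simps S_add J_in_H)
  show "smooth (c *\<^sub>R u) = c *\<^sub>R smooth u" for c u
    by (subst J_eq_iff[symmetric]) (simp add: J_smooth J_simps S_scale J_in_H)
qed

lemma inner_smooth: "inner (smooth u) v = inner u (smooth v)"
  unfolding smooth_def by (rule S_sym)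

lemma proj_smooth: "proj N (smooth v) = smooth (proj N v)"
  by (subst J_eq_iff[symmetric]) (simp add: J_smooth S_P flip: P_J)

lemma smooth_basis_0: "smooth (basis 0) = basis 0"
  by (subst J_eq_iff[symmetric]) (simp add: J_smooth S_e0)

lemma norm_smooth_le:
  assumes v: "proj N v = v"
  shows "norm (smooth v) \<le> C * norm v"
proof (cases "v = 0")
  case True
  then show ?thesis using linear_0[OF linear_smooth] by simp
next
  case False
  let ?w = "(1 / norm v) *\<^sub>R v"
  have "proj N ?w = ?w" by (simp add: linear_scale[OF linear_proj] v)
  then have "norm (smooth ?w) = ip_norm (ip 0) (S (J ?w))"
    using ip_norm_0_J[of "smooth ?w"] by (simp add: proj_smooth J_smooth)
  also have "\<dots> \<le> C" using False by (intro S_norm) simp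
  finally show ?thesis using False by (simp add: linear_scale[OF linear_smooth] divide_le_eq)
qed

lemma smoother_smooth: "smoother N C smooth"
  unfolding smoother_def
  using linear_smooth smooth_basis_0 norm_smooth_le proj_smooth inner_smooth[of "basis 0"]
  by (auto simp: smooth_basis_0)

text \<open>Let \<open>h\<close> be the limit of the partial sums in \<open>H\<^bsub>-\<nu>\<^esub>\<close>. The coefficient of the smoothed partial sum
  at \<open>e\<^sub>m\<close> is the inner product of that sum with \<open>S e\<^sub>m\<close>, which has no modes beyond \<open>N\<close>; hence it no
  longer changes once the index set contains \<open>{-N..N}\<close>. Since \<open>S\<close> and the coefficients are
  continuous on \<open>H\<^bsub>-\<nu>\<^esub>\<close>, the coefficients of \<open>S h\<close> are these eventual values.\<close>
lemma smoothed_limit: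
  fixes b :: "int \<Rightarrow> real"
  assumes lim: "limitin (ip_topology (H (-\<nu>)) (ip (-\<nu>))) (\<lambda>F. \<Sum>n\<in>F. b n *\<^sub>R J (basis n)) h
      (finite_subsets_at_top UNIV)"
  shows "h \<in> H (-\<nu>)" and "P (S h) = J (smooth (\<Sum>n=- int N..int N. b n *\<^sub>R basis n))"
proof -
  let ?V = "H (-\<nu>)" and ?g = "ip (-\<nu>)"
  interpret Metric_space ?V "ip_dist ?V ?g" by (rule metric)
  define part where "part F = (\<Sum>n\<in>F. b n *\<^sub>R basis n)" for F
  have Jpart: "J (part F) = (\<Sum>n\<in>F. b n *\<^sub>R J (basis n))" for F
    by (simp add: part_def J_simps)
  show h: "h \<in> ?V"
    using lim unfolding ip_topology_def by (simp add: limitin_mspace)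
  have near: "\<forall>\<^sub>F F in finite_subsets_at_top UNIV. ip_norm ?g (J (part F) - h) < \<epsilon>" if "0 < \<epsilon>" for \<epsilon>
    using lim that h unfolding ip_topology_def limitin_metric Jpart[symmetric]
    by (auto simp: ip_dist_def J_in_H elim: eventually_mono)
  obtain K where "\<forall>v\<in>?V. ip_norm ?g (S v) \<le> K * ip_norm ?g v"
    using S_bdd unfolding bounded_linear_between_def by blast
  then have K: "ip_norm ?g (S v) \<le> K * ip_norm ?g v" if "v \<in> ?V" for v
    using that by blast
  let ?I = "{- int N..int N}" and ?u = "inv J (S h)"
  have coeff: "inner (basis m) ?u = inner (basis m) (smooth (part ?I))" if m: "\<bar>m\<bar> \<le> int N" for m
  proof (rule ccontr)
    assume neq: "inner (basis m) ?u \<noteq> inner (basis m) (smooth (part ?I))"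
    define d where "d = eigenvalue basis L m powr (-\<nu>) * \<bar>inner (basis m) (smooth (part ?I) - ?u)\<bar>"
    have d: "0 < d" using neq eigenvalue_powr_pos[of m] by (simp add: d_def inner_diff_right)
    have "\<forall>\<^sub>F F in finite_subsets_at_top UNIV. ?I \<subseteq> F \<and> finite F"
      unfolding eventually_finite_subsets_at_top by (rule exI[of _ ?I]) auto
    moreover have "0 < d / (\<bar>K\<bar> + 1)" using d by simp
    note near[OF this]
    ultimately have "\<forall>\<^sub>F F in finite_subsets_at_top UNIV.
        (?I \<subseteq> F \<and> finite F) \<and> ip_norm ?g (J (part F) - h) < d / (\<bar>K\<bar> + 1)"
      by (rule eventually_conj)
    then have "\<exists>F. (?I \<subseteq> F \<and> finite F) \<and> ip_norm ?g (J (part F) - h) < d / (\<bar>K\<bar> + 1)"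
      by (rule eventually_happens'[OF finite_subsets_at_top_neq_bot])
    then obtain F where F: "?I \<subseteq> F" "finite F" "ip_norm ?g (J (part F) - h) < d / (\<bar>K\<bar> + 1)"
      by (elim exE conjE)
    have sm: "proj N (smooth (basis m)) = smooth (basis m)"
      using m by (simp add: proj_smooth proj_basis)
    have "inner (basis n) (smooth (basis m)) = 0" if "n \<notin> ?I" for n
      using inner_basis_proj[of n N "smooth (basis m)"] sm that by auto
    then have "inner (smooth (basis m)) (part F) = inner (smooth (basis m)) (part ?I)"
      unfolding part_def inner_sum_right using F(1,2)
      by (intro sum.mono_neutral_right) (auto simp: inner_commute)
    then have eq: "inner (basis m) (smooth (part F)) = inner (basis m) (smooth (part ?I))"
      by (simp add: inner_smooth)
    have "d = eigenvalue basis L m powr (-\<nu>) * \<bar>inner (basis m) (smooth (part F) - ?u)\<bar>"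
      by (simp add: d_def inner_diff_right eq)
    also have "\<dots> \<le> ip_norm ?g (J (smooth (part F) - ?u))" by (rule coefficient_le_ip_norm)
    also have "J (smooth (part F) - ?u) = S (J (part F) - h)"
      by (simp add: J_simps J_smooth S_range[OF h] S_diff h J_in_H)
    also have "ip_norm ?g \<dots> \<le> K * ip_norm ?g (J (part F) - h)"
      using ip_space h J_in_H by (intro K inner_product_on_minus)
    also have "\<dots> \<le> (\<bar>K\<bar> + 1) * ip_norm ?g (J (part F) - h)"
    proof (intro mult_right_mono)
      show "0 \<le> ip_norm ?g (J (part F) - h)"
        using ip_space h J_in_H inner_product_on_minus[OF ip_space]
        unfolding ip_norm_def by (auto simp: inner_product_on_def)
    qed auto
    also have "\<dots> < d" using F(3) by (simp add: pos_less_divide_eq mult.commute)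
    finally show False by simp
  qed
  have pp: "proj N (part ?I) = part ?I" unfolding part_def by (rule proj_sum_basis)
  have "proj N ?u = proj N (smooth (part ?I))"
    unfolding proj_def by (intro sum.cong refl arg_cong2[where f = scaleR] coeff) auto
  also have "\<dots> = smooth (part ?I)" by (simp add: proj_smooth pp)
  finally show "P (S h) = J (smooth (\<Sum>n=- int N..int N. b n *\<^sub>R basis n))"
    using P_J[of ?u] by (simp add: S_range[OF h] part_def)
qed

lemma galerkin_step:
  assumes X: "J X' = P (S (J X + c *\<^sub>R J F + (h' - h)))"
    and h: "limitin (ip_topology (H (-\<nu>)) (ip (-\<nu>))) (\<lambda>F. \<Sum>n\<in>F. b n *\<^sub>R J (basis n)) h
      (finite_subsets_at_top UNIV)"
    and h': "limitin (ip_topology (H (-\<nu>)) (ip (-\<nu>))) (\<lambda>F. \<Sum>n\<in>F. b' n *\<^sub>R J (basis n)) h'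
      (finite_subsets_at_top UNIV)"
  shows "X' = smooth (proj N X + c *\<^sub>R proj N F + (\<Sum>n=- int N..int N. (b' n - b n) *\<^sub>R basis n))"
proof -
  note lp = linear_add[OF linear_proj] linear_diff[OF linear_proj] linear_scale[OF linear_proj]
  note ls = linear_add[OF linear_smooth] linear_diff[OF linear_smooth] linear_scale[OF linear_smooth]
  have V: "h \<in> H (-\<nu>)" "h' \<in> H (-\<nu>)" using smoothed_limit(1) h h' by auto
  have V': "h' - h \<in> H (-\<nu>)" using ip_space V by (intro inner_product_on_minus)
  have "S (J X + c *\<^sub>R J F + (h' - h)) = S (J (X + c *\<^sub>R F)) + (S h' - S h)"
    using V V' by (simp add: S_add S_diff J_in_H flip: J_simps(1,3))
  also have "\<dots> = J (smooth (X + c *\<^sub>R F) + (inv J (S h') - inv J (S h)))"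
    using V by (simp add: J_simps J_smooth S_range)
  finally have "J X' = J (proj N (smooth (X + c *\<^sub>R F)) + (proj N (inv J (S h')) - proj N (inv J (S h))))"
    using X by (simp add: P_J lp)
  moreover have "proj N (inv J (S h)) = smooth (\<Sum>n=- int N..int N. b n *\<^sub>R basis n)"
    using smoothed_limit(2)[OF h] P_J[of "inv J (S h)"] V by (simp add: S_range J_eq_iff)
  moreover have "proj N (inv J (S h')) = smooth (\<Sum>n=- int N..int N. b' n *\<^sub>R basis n)"
    using smoothed_limit(2)[OF h'] P_J[of "inv J (S h')"] V by (simp add: S_range J_eq_iff)
  ultimately have "X' = smooth (proj N (X + c *\<^sub>R F)) + (smooth (\<Sum>n=- int N..int N. b' n *\<^sub>R basis n)
      - smooth (\<Sum>n=- int N..int N. b n *\<^sub>R basis n))"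
    by (simp add: J_eq_iff proj_smooth)
  then show ?thesis by (simp add: lp scaleR_diff_left sum_subtractf flip: ls)
qed

end

section \<open>Gaussian lower bounds and asymptotics\<close>

text \<open>On the interval, the Gaussian density is at least its value at the outer radius \<open>B\<close>.\<close>
lemma normal_interval_measure_ge:
  fixes X :: "'w \<Rightarrow> real"
  assumes M: "prob_space M" and X: "distributed M lborel X (normal_density 0 \<sigma>)"
    and \<sigma>: "0 < \<sigma>" and \<delta>: "0 \<le> \<delta>" and B: "\<bar>c\<bar> + \<delta> \<le> B"
  shows "2 * \<delta> / sqrt (2 * pi * \<sigma>\<^sup>2) * exp (- B\<^sup>2 / (2 * \<sigma>\<^sup>2))
    \<le> measure M {\<omega> \<in> space M. \<bar>X \<omega> - c\<bar> \<le> \<delta>}"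
proof -
  interpret prob_space M by (rule M)
  let ?k = "1 / sqrt (2 * pi * \<sigma>\<^sup>2) * exp (- B\<^sup>2 / (2 * \<sigma>\<^sup>2))"
  have eq: "{\<omega> \<in> space M. \<bar>X \<omega> - c\<bar> \<le> \<delta>} = X -` {c - \<delta>..c + \<delta>} \<inter> space M" by auto
  have "emeasure lborel {c - \<delta>..c + \<delta>} = ennreal (2 * \<delta>)"
    using \<delta> by (subst emeasure_lborel_Icc) auto
  then have "ennreal (?k * (2 * \<delta>)) = ennreal ?k * emeasure lborel {c - \<delta>..c + \<delta>}"
    using \<delta> by (simp only:) (rule ennreal_mult; simp)
  also have "\<dots> = (\<integral>\<^sup>+x. ennreal ?k * indicator {c - \<delta>..c + \<delta>} x \<partial>lborel)"
    by (subst nn_integral_cmult_indicator) auto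
  also have "\<dots> \<le> (\<integral>\<^sup>+x. ennreal (normal_density 0 \<sigma> x) * indicator {c - \<delta>..c + \<delta>} x \<partial>lborel)"
  proof (intro nn_integral_mono)
    fix x
    show "ennreal ?k * indicator {c - \<delta>..c + \<delta>} x \<le> ennreal (normal_density 0 \<sigma> x) * indicator {c - \<delta>..c + \<delta>} x"
    proof (cases "x \<in> {c - \<delta>..c + \<delta>}")
      case True
      then have "\<bar>x\<bar> \<le> B" using B by auto
      then have "x\<^sup>2 \<le> B\<^sup>2" using abs_le_square_iff[of x B] by linarith
      then have "exp (- B\<^sup>2 / (2 * \<sigma>\<^sup>2)) \<le> exp (- (x - 0)\<^sup>2 / (2 * \<sigma>\<^sup>2))"
        by (simp add: divide_right_mono)
      then have "?k \<le> normal_density 0 \<sigma> x"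
        unfolding normal_density_def by (intro mult_left_mono) auto
      then show ?thesis using True by (simp add: ennreal_leI)
    qed simp
  qed
  also have "\<dots> = emeasure M (X -` {c - \<delta>..c + \<delta>} \<inter> space M)"
    using distributed_emeasure[OF X, of "{c - \<delta>..c + \<delta>}"] by simp
  also have "\<dots> = ennreal (measure M {\<omega> \<in> space M. \<bar>X \<omega> - c\<bar> \<le> \<delta>})"
    by (simp add: emeasure_eq_measure eq)
  finally show ?thesis by (simp add: mult_ac)
qed

text \<open>Independence is used twice: across the modes for the path-valued random variables, and for each
  mode across the time steps. Each of the \<open>N * card I\<close> increments is a centred Gaussian variable of
  variance \<open>T / N\<close>.\<close>
lemma brownian_tube_prob_ge:
  fixes \<beta> :: "'i \<Rightarrow> real \<Rightarrow> 'w \<Rightarrow> real" and t :: "'i \<Rightarrow> nat \<Rightarrow> real"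
  assumes M: "prob_space M" and T: "0 < T" and N: "1 \<le> N"
    and bm: "\<And>m. std_brownian_motion M T (\<beta> m)"
    and indep: "prob_space.indep_vars M (\<lambda>_. PiM {0..T} (\<lambda>_. borel)) (\<lambda>n \<omega>. \<lambda>t\<in>{0..T}. \<beta> n t \<omega>) UNIV"
    and I: "finite I" "I \<noteq> {}"
    and \<delta>: "0 \<le> \<delta>" and t: "\<And>m n. m \<in> I \<Longrightarrow> n < N \<Longrightarrow> \<bar>t m n\<bar> + \<delta> \<le> B"
  defines "tube \<equiv> {\<omega> \<in> space M. \<forall>m\<in>I. \<forall>n<N.
      \<bar>\<beta> m (real (n + 1) * T / real N) \<omega> - \<beta> m (real n * T / real N) \<omega> - t m n\<bar> \<le> \<delta>}"
  shows "tube \<in> sets M"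
    and "(2 * \<delta> / sqrt (2 * pi * (T / real N)) * exp (- B\<^sup>2 / (2 * (T / real N)))) ^ (N * card I)
      \<le> measure M tube"
proof -
  interpret prob_space M by (rule M)
  define \<tau> where "\<tau> n = real n * T / real N" for n
  define g where "g = 2 * \<delta> / sqrt (2 * pi * (T / real N)) * exp (- B\<^sup>2 / (2 * (T / real N)))"
  have N0: "0 < real N" using N by simp
  have \<tau>_mono: "\<tau> n < \<tau> (Suc n)" for n using T N0 by (simp add: \<tau>_def divide_strict_right_mono)
  have \<tau>_diff: "\<tau> (Suc n) - \<tau> n = T / real N" for n by (simp add: \<tau>_def add_divide_distrib distrib_right)
  have \<tau>_in: "\<tau> n \<in> {0..T}" if "n \<le> N" for n
    using that T N0 by (auto simp: \<tau>_def divide_le_eq mult.commute)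
  have \<tau>0: "\<tau> 0 = 0" and \<tau>N: "\<tau> N = T" using N0 by (auto simp: \<tau>_def)
  define inc where "inc m n \<omega> = \<beta> m (\<tau> (Suc n)) \<omega> - \<beta> m (\<tau> n) \<omega>" for m n \<omega>
  define path where "path m \<omega> = (\<lambda>t\<in>{0..T}. \<beta> m t \<omega>)" for m \<omega>
  define A where "A m = {f \<in> space (PiM {0..T} (\<lambda>_. borel :: real measure)).
    \<forall>n\<in>{..<N}. \<bar>f (\<tau> (Suc n)) - f (\<tau> n) - t m n\<bar> \<le> \<delta>}" for m
  have A: "A m \<in> sets (PiM {0..T} (\<lambda>_. borel))" for m
  proof -
    have [measurable]: "(\<lambda>f. f (\<tau> n)) \<in> borel_measurable (PiM {0..T} (\<lambda>_. borel :: real measure))" if "n \<le> N" for n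
      using measurable_component_singleton[OF \<tau>_in[OF that], of "\<lambda>_. borel"] .
    have "{f \<in> space (PiM {0..T} (\<lambda>_. borel :: real measure)). \<bar>f (\<tau> (Suc n)) - f (\<tau> n) - t m n\<bar> \<le> \<delta>}
        \<in> sets (PiM {0..T} (\<lambda>_. borel))" if "n \<in> {..<N}" for n
    proof -
      have "Suc n \<le> N" "n \<le> N" using that by auto
      then show ?thesis by measurable
    qed
    then show ?thesis unfolding A_def by (intro sets.sets_Collect_finite_All) auto
  qed
  have indep': "indep_vars (\<lambda>_. PiM {0..T} (\<lambda>_. borel)) path UNIV"
    using indep by (simp add: path_def[abs_def])
  have path: "path m \<in> measurable M (PiM {0..T} (\<lambda>_. borel))" for m
    using indep' unfolding indep_vars_def by simp
  have pre: "path m -` A m \<inter> space M = {\<omega> \<in> space M. \<forall>n<N. \<bar>inc m n \<omega> - t m n\<bar> \<le> \<delta>}" for m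
    using \<tau>_in by (auto simp: A_def path_def inc_def space_PiM PiE_def)
  have tube: "tube = (\<Inter>m\<in>I. path m -` A m \<inter> space M)"
    unfolding pre using I(2) by (auto simp: tube_def inc_def \<tau>_def)
  show "tube \<in> sets M"
    unfolding tube using path A I by (intro sets.finite_INT measurable_sets) auto
  have g0: "0 \<le> g" using \<delta> T by (simp add: g_def)
  have mode: "g ^ N \<le> prob (path m -` A m \<inter> space M)" if m: "m \<in> I" for m
  proof -
    have ind: "indep_vars (\<lambda>_. borel) (\<lambda>n \<omega>. inc m n \<omega>) {..<N}"
      unfolding inc_def using bm[of m] \<tau>_mono unfolding std_brownian_motion_def
      by (elim conjE allE[of _ N] allE[of _ \<tau>] impE) (auto simp: \<tau>0 \<tau>N less_imp_le)
    have "path m -` A m \<inter> space M = (\<Inter>n\<in>{..<N}. inc m n -` {t m n - \<delta>..t m n + \<delta>} \<inter> space M)"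
    proof -
      have "0 \<in> {..<N}" using N by simp
      moreover have "\<bar>x - u\<bar> \<le> \<delta> \<longleftrightarrow> x \<in> {u - \<delta>..u + \<delta>}" for x u by auto
      ultimately show ?thesis unfolding pre by auto
    qed
    also have "prob \<dots> = (\<Prod>n\<in>{..<N}. prob (inc m n -` {t m n - \<delta>..t m n + \<delta>} \<inter> space M))"
      using N by (intro indep_varsD_finite[OF ind]) (auto simp: lessThan_empty_iff)
    also have "\<dots> \<ge> (\<Prod>n\<in>{..<N}. g)"
    proof (intro prod_mono conjI g0)
      fix n assume n: "n \<in> {..<N}"
      have "0 \<le> \<tau> n" "\<tau> (Suc n) \<le> T" using \<tau>_in[of n] \<tau>_in[of "Suc n"] n by auto
      then have "distributed M lborel (\<lambda>\<omega>. \<beta> m (\<tau> (Suc n)) \<omega> - \<beta> m (\<tau> n) \<omega>)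
          (normal_density 0 (sqrt (\<tau> (Suc n) - \<tau> n)))"
        using bm[of m] \<tau>_mono[of n] unfolding std_brownian_motion_def by blast
      then have d: "distributed M lborel (inc m n) (normal_density 0 (sqrt (T / real N)))"
        by (simp add: inc_def[abs_def] \<tau>_diff)
      have "g \<le> prob {\<omega> \<in> space M. \<bar>inc m n \<omega> - t m n\<bar> \<le> \<delta>}"
        using normal_interval_measure_ge[OF M d _ \<delta> t[OF m]] n T N0 by (simp add: g_def)
      also have "{\<omega> \<in> space M. \<bar>inc m n \<omega> - t m n\<bar> \<le> \<delta>} = inc m n -` {t m n - \<delta>..t m n + \<delta>} \<inter> space M"
        by auto
      finally show "g \<le> prob (inc m n -` {t m n - \<delta>..t m n + \<delta>} \<inter> space M)" .
    qed
    finally show ?thesis by simp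
  qed
  have "g ^ (N * card I) = (\<Prod>m\<in>I. g ^ N)" by (simp add: power_mult)
  also have "\<dots> \<le> (\<Prod>m\<in>I. prob (path m -` A m \<inter> space M))"
    using mode g0 by (intro prod_mono) auto
  also have "\<dots> = prob tube"
    unfolding tube using I A by (intro indep_varsD[OF indep', symmetric]) auto
  finally show "(2 * \<delta> / sqrt (2 * pi * (T / real N)) * exp (- B\<^sup>2 / (2 * (T / real N)))) ^ (N * card I)
      \<le> measure M tube" by (simp add: g_def)
qed

text \<open>Each single factor is at least the exponential of \<open>- D N ^ (2 q + 1)\<close>: this covers the Gaussian
  exponent with targets of size \<open>N\<^sup>q\<close>, and the width of the interval since
  \<open>N * ln (\<Theta> N)\<close> is of smaller order. There are at most \<open>3 N\<^sup>2\<close> factors.\<close>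
lemma tube_prob_lower_exp:
  fixes T \<epsilon> \<Theta> b :: real and q :: nat
  assumes T: "0 < T" and \<epsilon>: "0 < \<epsilon>" and \<Theta>: "1 \<le> \<Theta>" and b: "0 \<le> b" and q: "1 \<le> q"
  shows "\<exists>D. \<forall>N\<ge>1. exp (- D * real N ^ (2 * q + 3)) \<le>
    (2 * (\<epsilon> / (3 * real N * real N * (\<Theta> * real N) ^ N)) / sqrt (2 * pi * (T / real N))
      * exp (- (b * real N ^ q + 1)\<^sup>2 / (2 * (T / real N)))) ^ (N * (2 * N + 1))"
proof -
  define c where "c = 2 * \<epsilon> / (3 * sqrt (2 * pi * T))"
  define D where "D = \<bar>ln c\<bar> + 3 * \<Theta> + (b + 1)\<^sup>2 / (2 * T)"
  have c: "0 < c" using \<epsilon> T by (simp add: c_def)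
  have D: "0 \<le> D" using \<Theta> T by (simp add: D_def)
  have "exp (- (3 * D) * real N ^ (2 * q + 3)) \<le>
    (2 * (\<epsilon> / (3 * real N * real N * (\<Theta> * real N) ^ N)) / sqrt (2 * pi * (T / real N))
      * exp (- (b * real N ^ q + 1)\<^sup>2 / (2 * (T / real N)))) ^ (N * (2 * N + 1))"
    (is "_ \<le> ?g ^ _") if N: "1 \<le> N" for N
  proof -
    let ?K = "real N ^ (2 * q + 1)"
    have N1: "1 \<le> real N" using N by simp
    have \<Theta>N: "1 \<le> \<Theta> * real N" using \<Theta> N1 mult_mono[of 1 \<Theta> 1 "real N"] by simp
    have K: "1 \<le> ?K" "real N * real N \<le> ?K"
      using one_le_power[OF N1] power_increasing[of 2 "2 * q + 1" "real N"] N1 q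
      by (auto simp only: power2_eq_square)
    have e1: "exp (- \<bar>ln c\<bar> * ?K) \<le> c"
    proof -
      have "\<bar>ln c\<bar> * 1 \<le> \<bar>ln c\<bar> * ?K" using K by (intro mult_left_mono) auto
      then have "exp (- \<bar>ln c\<bar> * ?K) \<le> exp (ln c)" by (subst exp_le_cancel_iff) linarith
      then show ?thesis using c by simp
    qed
    have e2: "exp (- (3 * \<Theta>) * ?K) \<le> 1 / (real N * real N * (\<Theta> * real N) ^ N)"
    proof -
      have NN: "real N \<le> \<Theta> * real N" using \<Theta> N1 by simp
      have "real N * real N * (\<Theta> * real N) ^ N \<le> (\<Theta> * real N) * (\<Theta> * real N) * (\<Theta> * real N) ^ N"
        using NN N1 \<Theta>N by (intro mult_mono) auto
      also have "\<dots> = (\<Theta> * real N) ^ (N + 2)" by simp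
      also have "\<dots> \<le> exp (\<Theta> * real N) ^ (N + 2)"
        using \<Theta>N exp_ge_add_one_self[of "\<Theta> * real N"] by (intro power_mono) linarith+
      also have "\<dots> = exp (real (N + 2) * (\<Theta> * real N))" by (simp only: exp_of_nat_mult)
      also have "\<dots> \<le> exp (3 * \<Theta> * ?K)"
      proof (subst exp_le_cancel_iff)
        have "real (N + 2) * (\<Theta> * real N) \<le> (3 * real N) * (\<Theta> * real N)"
          using N1 \<Theta>N by (intro mult_right_mono) auto
        also have "\<dots> = 3 * \<Theta> * (real N * real N)" by simp
        also have "\<dots> \<le> 3 * \<Theta> * ?K" using K \<Theta> by (intro mult_left_mono) auto
        finally show "real (N + 2) * (\<Theta> * real N) \<le> 3 * \<Theta> * ?K" .
      qed
      finally have "real N * real N * (\<Theta> * real N) ^ N \<le> exp (3 * \<Theta> * ?K)" .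
      moreover have "0 < real N * real N * (\<Theta> * real N) ^ N" using N1 \<Theta> by simp
      ultimately have "inverse (exp (3 * \<Theta> * ?K)) \<le> inverse (real N * real N * (\<Theta> * real N) ^ N)"
        by (intro le_imp_inverse_le)
      then show ?thesis by (simp add: exp_minus inverse_eq_divide)
    qed
    have e3: "exp (- ((b + 1)\<^sup>2 / (2 * T)) * ?K) \<le> exp (- (b * real N ^ q + 1)\<^sup>2 / (2 * (T / real N)))"
    proof (subst exp_le_cancel_iff)
      have "b * real N ^ q + 1 \<le> (b + 1) * real N ^ q"
        using one_le_power[OF N1, of q] by (simp add: algebra_simps)
      then have "(b * real N ^ q + 1)\<^sup>2 \<le> ((b + 1) * real N ^ q)\<^sup>2"
        using b by (intro power_mono) auto
      then have "(b * real N ^ q + 1)\<^sup>2 * real N / (2 * T) \<le> ((b + 1) * real N ^ q)\<^sup>2 * real N / (2 * T)"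
        using T by (intro divide_right_mono mult_right_mono) auto
      also have "((b + 1) * real N ^ q)\<^sup>2 * real N = (b + 1)\<^sup>2 * ?K"
        by (simp add: power_mult_distrib power_mult[symmetric] mult.commute)
      finally show "- ((b + 1)\<^sup>2 / (2 * T)) * ?K \<le> - (b * real N ^ q + 1)\<^sup>2 / (2 * (T / real N))"
        by simp
    qed
    have sq: "sqrt (2 * pi * (T / real N)) \<le> sqrt (2 * pi * T)" "0 < sqrt (2 * pi * (T / real N))"
    proof -
      have "T / real N \<le> T / 1" using T N1 by (intro divide_left_mono) auto
      then show "sqrt (2 * pi * (T / real N)) \<le> sqrt (2 * pi * T)"
        by (intro real_sqrt_le_mono mult_left_mono) auto
      show "0 < sqrt (2 * pi * (T / real N))" using T N1 by simp
    qed
    have "exp (- D * ?K) = exp (- \<bar>ln c\<bar> * ?K) * exp (- (3 * \<Theta>) * ?K) * exp (- ((b + 1)\<^sup>2 / (2 * T)) * ?K)"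
      by (simp add: D_def algebra_simps flip: exp_add)
    also have "\<dots> \<le> c * (1 / (real N * real N * (\<Theta> * real N) ^ N)) * exp (- (b * real N ^ q + 1)\<^sup>2 / (2 * (T / real N)))"
      using c e1 e2 e3 N1 \<Theta> by (intro mult_mono) auto
    also have "\<dots> \<le> ?g"
    proof (intro mult_right_mono)
      let ?d = "2 * (\<epsilon> / (3 * real N * real N * (\<Theta> * real N) ^ N))"
      have "c * (1 / (real N * real N * (\<Theta> * real N) ^ N)) = ?d / sqrt (2 * pi * T)"
        by (simp add: c_def)
      also have "\<dots> \<le> ?d / sqrt (2 * pi * (T / real N))"
        using sq \<epsilon> \<Theta> T by (intro divide_left_mono) auto
      finally show "c * (1 / (real N * real N * (\<Theta> * real N) ^ N)) \<le> ?d / sqrt (2 * pi * (T / real N))" .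
    qed auto
    finally have "exp (- D * ?K) ^ (N * (2 * N + 1)) \<le> ?g ^ (N * (2 * N + 1))"
      by (intro power_mono) auto
    moreover have "exp (- (3 * D) * real N ^ (2 * q + 3)) \<le> exp (- D * ?K) ^ (N * (2 * N + 1))"
    proof -
      have "real (N * (2 * N + 1)) * (D * ?K) \<le> (real N * (3 * real N)) * (D * ?K)"
        using N1 D K by (intro mult_right_mono) auto
      also have "\<dots> = 3 * D * real N ^ (2 * q + 3)"
        by (simp add: power_add power3_eq_cube mult_ac)
      finally have "- (3 * D) * real N ^ (2 * q + 3) \<le> real (N * (2 * N + 1)) * (- D * ?K)" by simp
      then show ?thesis by (simp only: exp_of_nat_mult[symmetric] exp_le_cancel_iff)
    qed
    ultimately show ?thesis by linarith
  qed
  then show ?thesis by (intro exI[of _ "3 * D"]) auto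
qed

lemma double_exponential_beats_exponential:
  fixes p D :: real
  assumes p: "0 < p"
  shows "(\<lambda>N. ennreal (exp (- D * real N ^ k) * (2 ^ 2 ^ (N - 1)) powr p)) \<longlonglongrightarrow> \<infinity>"
proof -
  define c where "c = p * ln 2 / 2"
  have c: "0 < c" using p by (simp add: c_def)
  have "filterlim (\<lambda>N. exp (real N * ln 2)) at_top sequentially"
    by (intro filterlim_compose[OF exp_at_top] filterlim_at_top_mult_tendsto_pos[OF tendsto_const _ filterlim_real_sequentially])
      simp
  then have two: "filterlim (\<lambda>N. (2::real) ^ N) at_top sequentially"
    by (simp add: exp_of_nat_mult)
  have "(\<lambda>N. (real N * ln 2) ^ k / exp (real N * ln 2)) \<longlonglongrightarrow> 0"
    by (rule filterlim_compose[OF tendsto_power_div_exp_0])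
      (auto intro!: filterlim_at_top_mult_tendsto_pos[OF tendsto_const _ filterlim_real_sequentially])
  then have "(\<lambda>N. \<bar>D\<bar> / ln 2 ^ k * ((real N * ln 2) ^ k / exp (real N * ln 2))) \<longlonglongrightarrow> \<bar>D\<bar> / ln 2 ^ k * 0"
    by (rule tendsto_mult_left)
  also have "(\<lambda>N. \<bar>D\<bar> / ln 2 ^ k * ((real N * ln 2) ^ k / exp (real N * ln 2))) = (\<lambda>N. \<bar>D\<bar> * real N ^ k / 2 ^ N)"
    by (simp add: fun_eq_iff power_mult_distrib exp_of_nat_mult)
  finally have "\<forall>\<^sub>F N in sequentially. \<bar>D\<bar> * real N ^ k / 2 ^ N < c / 2"
    using c by (intro order_tendstoD) auto
  then have ev: "\<forall>\<^sub>F N in sequentially. exp (c / 2 * 2 ^ N) \<le> exp (- D * real N ^ k) * (2 ^ 2 ^ (N - 1)) powr p"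
    using eventually_ge_at_top[of 1]
  proof eventually_elim
    case (elim N)
    have "((2::real) ^ 2 ^ (N - 1)) powr p = exp (p * (2 ^ (N - 1) * ln 2))"
      by (simp add: powr_def ln_realpow)
    also have "p * (2 ^ (N - 1) * ln 2) = c * 2 ^ N"
      using elim by (cases N) (auto simp: c_def)
    finally have eq: "exp (- D * real N ^ k) * (2 ^ 2 ^ (N - 1)) powr p = exp (c * 2 ^ N - D * real N ^ k)"
      by (simp flip: exp_add)
    have "D * real N ^ k \<le> \<bar>D\<bar> * real N ^ k" by (intro mult_right_mono) auto
    also have "\<dots> \<le> c / 2 * 2 ^ N" using elim by (simp add: divide_less_eq)
    finally show ?case unfolding eq by simp
  qed
  show ?thesis
    unfolding infinity_ennreal_def tendsto_top_iff_ennreal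
  proof (intro allI impI)
    fix l :: real assume "0 \<le> l"
    have "filterlim (\<lambda>N. exp (c / 2 * 2 ^ N)) at_top sequentially"
      using c by (intro filterlim_compose[OF exp_at_top] filterlim_tendsto_pos_mult_at_top[OF tendsto_const]
          two) auto
    then have "\<forall>\<^sub>F N in sequentially. l < exp (c / 2 * 2 ^ N)"
      by (simp add: filterlim_at_top_dense)
    with ev show "\<forall>\<^sub>F N in sequentially. ennreal l < ennreal (exp (- D * real N ^ k) * (2 ^ 2 ^ (N - 1)) powr p)"
      by eventually_elim (use \<open>0 \<le> l\<close> in \<open>auto intro!: ennreal_lessI elim: less_le_trans\<close>)
  qed
qed

section \<open>Divergence of the moments\<close>

lemma norm_basis_sum_le:
  assumes N: "1 \<le> N" and c: "\<And>n. n \<in> {- int N..int N} \<Longrightarrow> \<bar>c n\<bar> \<le> \<delta>"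
  shows "norm (\<Sum>n=- int N..int N. c n *\<^sub>R basis n) \<le> 3 * real N * \<delta>"
proof -
  have "norm (\<Sum>n=- int N..int N. c n *\<^sub>R basis n) \<le> (\<Sum>n=- int N..int N. \<bar>c n\<bar>)"
    by (rule order_trans[OF norm_sum]) simp
  also have "\<dots> \<le> (\<Sum>n=- int N..int N. \<delta>)" by (intro sum_mono c)
  also have "\<dots> = (2 * real N + 1) * \<delta>" by simp
  also have "\<dots> \<le> (3 * real N) * \<delta>"
  proof (intro mult_right_mono)
    show "0 \<le> \<delta>" using c[of 0] by simp
  qed (use N in auto)
  finally show ?thesis by simp
qed

text \<open>The first noise increment has to cancel the deterministic part of the first step and to put the
  value \<open>2 \<Lambda> N + 1\<close> in its place. The \<open>L\<^sup>2\<close> norm of the initial value is at most \<open>X\<close>,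
  so its supremum is at most a multiple of \<open>N\<close>, and the target is of order \<open>N\<^sup>q\<close> at most.\<close>
lemma kick_target_le:
  fixes a :: "nat \<Rightarrow> real" and q :: nat and \<Lambda> T :: real
  assumes T: "0 < T" and q: "1 \<le> q" and \<Lambda>: "0 \<le> \<Lambda>" and N: "1 \<le> N" and x: "norm x \<le> X"
    and y: "y = proj N x"
  shows "norm ((2 * \<Lambda> * real N + 1) *\<^sub>R basis 0 - y - (T / real N) *\<^sub>R nemytskii a q y)
    \<le> (2 * \<Lambda> + 1 + X + T * (\<Sum>k\<le>q. \<bar>a k\<bar> * (6 * X) ^ k)) * real N ^ q"
proof -
  have N1: "1 \<le> real N" using N by simp
  have K: "1 \<le> real N ^ q" "real N \<le> real N ^ q"
    using one_le_power[OF N1] power_increasing[OF q N1] by auto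
  have yX: "norm y \<le> X" using norm_proj_le[of N x] x y by simp
  have "norm x \<ge> 0" by simp
  then have X: "0 \<le> X" using x by linarith
  have "norm (nemytskii a q y) \<le> (\<Sum>k\<le>q. \<bar>a k\<bar> * (6 * real N * norm y) ^ k)"
    using y N by (intro norm_nemytskii_le) (simp_all add: proj_proj)
  also have "\<dots> \<le> (\<Sum>k\<le>q. \<bar>a k\<bar> * ((6 * X) ^ k * real N ^ q))"
  proof (intro sum_mono mult_left_mono)
    fix k assume "k \<in> {..q}"
    have "(6 * real N * norm y) ^ k \<le> (6 * real N * X) ^ k"
      using yX by (intro power_mono mult_left_mono) auto
    also have "\<dots> = (6 * X) ^ k * real N ^ k" by (simp add: power_mult_distrib)
    also have "\<dots> \<le> (6 * X) ^ k * real N ^ q"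
      using X N1 \<open>k \<in> {..q}\<close> by (intro mult_left_mono power_increasing) auto
    finally show "(6 * real N * norm y) ^ k \<le> (6 * X) ^ k * real N ^ q" .
  qed auto
  finally have F: "norm (nemytskii a q y) \<le> (\<Sum>k\<le>q. \<bar>a k\<bar> * (6 * X) ^ k) * real N ^ q"
    by (simp add: sum_distrib_right mult.assoc)
  have "T / real N \<le> T / 1" using T N1 by (intro divide_left_mono) auto
  then have TF: "T / real N * norm (nemytskii a q y) \<le> T * ((\<Sum>k\<le>q. \<bar>a k\<bar> * (6 * X) ^ k) * real N ^ q)"
    using F T by (intro mult_mono) auto
  have "norm ((2 * \<Lambda> * real N + 1) *\<^sub>R basis 0 - y - (T / real N) *\<^sub>R nemytskii a q y)
      \<le> norm ((2 * \<Lambda> * real N + 1) *\<^sub>R basis 0) + norm y + norm ((T / real N) *\<^sub>R nemytskii a q y)"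
    by (intro order_trans[OF norm_triangle_ineq4] add_right_mono norm_triangle_ineq4)
  also have "\<dots> \<le> (2 * \<Lambda> * real N ^ q + 1 * real N ^ q) + X * real N ^ q
      + T * ((\<Sum>k\<le>q. \<bar>a k\<bar> * (6 * X) ^ k) * real N ^ q)"
  proof (intro add_mono)
    have "2 * \<Lambda> * real N \<le> 2 * \<Lambda> * real N ^ q" using K \<Lambda> by (intro mult_left_mono) auto
    then show "norm ((2 * \<Lambda> * real N + 1) *\<^sub>R basis 0) \<le> 2 * \<Lambda> * real N ^ q + 1 * real N ^ q"
      using K \<Lambda> by simp
    show "norm y \<le> X * real N ^ q" using yX mult_left_mono[OF K(1) X] by simp
    show "norm ((T / real N) *\<^sub>R nemytskii a q y) \<le> T * ((\<Sum>k\<le>q. \<bar>a k\<bar> * (6 * X) ^ k) * real N ^ q)"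
      using TF T by simp
  qed
  also have "\<dots> = (2 * \<Lambda> + 1 + X + T * (\<Sum>k\<le>q. \<bar>a k\<bar> * (6 * X) ^ k)) * real N ^ q"
    by (simp add: algebra_simps)
  finally show ?thesis .
qed

lemma uniform_bound_at_0:
  fixes f :: "nat \<Rightarrow> real \<Rightarrow> L2 \<Rightarrow> real"
  assumes "(SUP N\<in>{1..}. SUP s\<in>{0..1}. SUP w\<in>{w. norm w \<le> 1}.
      ereal (real N powr (- s) * f N s w)) < \<infinity>"
  shows "\<exists>C\<ge>0. \<forall>N\<ge>1. \<forall>w. norm w \<le> 1 \<longrightarrow> f N 0 w \<le> C"
proof -
  let ?s = "SUP N\<in>{1..}. SUP s\<in>{0..1}. SUP w\<in>{w. norm w \<le> 1}. ereal (real N powr (- s) * f N s w)"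
  obtain C where C: "?s \<le> ereal C"
    using assms by (cases ?s) auto
  have "f N 0 w \<le> max 0 C" if N: "1 \<le> N" and w: "norm w \<le> 1" for N w
  proof -
    have "ereal (real N powr (- 0) * f N 0 w) \<le> (SUP w\<in>{w. norm w \<le> 1}. ereal (real N powr (- 0) * f N 0 w))"
      using w by (intro SUP_upper) auto
    also have "\<dots> \<le> (SUP s\<in>{0..1}. SUP w\<in>{w. norm w \<le> 1}. ereal (real N powr (- s) * f N s w))"
      by (rule SUP_upper[where i = 0]) auto
    also have "\<dots> \<le> ?s" using N by (intro SUP_upper) auto
    also note C
    finally show ?thesis using N by simp
  qed
  then show ?thesis by (intro exI[of _ "max 0 C"]) auto
qed

text \<open>For each \<open>N\<close> the tube \<open>E\<close> is chosen around the increments that annihilate the first step and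
  replace it by the constant \<open>2 \<Lambda> N + 1\<close>. The moment is bounded below by its part over \<open>E\<close>.\<close>

theorem theorem3p7:
  fixes e :: "int \<Rightarrow> L2"
    and D_A :: "L2 set" and A :: "L2 \<Rightarrow> L2"
    and T \<eta> chi \<nu> :: real
    and J :: "L2 \<Rightarrow> 'v::real_vector"
    and H :: "real \<Rightarrow> 'v set"
    and ip :: "real \<Rightarrow> 'v \<Rightarrow> 'v \<Rightarrow> real"
    and P S :: "nat \<Rightarrow> 'v \<Rightarrow> 'v"
    and M :: "'w measure"
    and q :: nat and a :: "nat \<Rightarrow> real"
    and \<xi> :: 'v
    and W :: "real \<Rightarrow> 'w \<Rightarrow> 'v"
    and Y :: "nat \<Rightarrow> nat \<Rightarrow> 'w \<Rightarrow> L2"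
  assumes e_0: "e 0 = L2_of (\<lambda>x. 1)"
    and e_pos: "\<And>n::nat. n \<ge> 1 \<Longrightarrow> e (int n) = L2_of (\<lambda>x. sqrt 2 * cos (2 * real n * pi * x))"
    and e_neg: "\<And>n::nat. n \<ge> 1 \<Longrightarrow> e (- int n) = L2_of (\<lambda>x. sqrt 2 * sin (2 * real n * pi * x))"
    and D_A: "D_A = {v. (\<lambda>n. real_of_int n ^ 4 * \<bar>inner (e n) v\<bar>\<^sup>2) summable_on UNIV}"
    and A: "\<And>v. v \<in> D_A \<Longrightarrow>
              A v = (\<Sum>\<^sub>\<infinity>n. (- 4 * pi\<^sup>2 * (real_of_int n)\<^sup>2 * inner (e n) v) *\<^sub>R e n)"
    and T: "0 < T" and \<eta>: "0 < \<eta>"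
    and interp: "interpolation_spaces e (\<lambda>v. \<eta> *\<^sub>R v - A v) J H ip"
    and P_bdd: "\<And>N. N \<ge> 1 \<Longrightarrow> bounded_linear_between (H (-1)) (ip (-1)) (H 1) (ip 1) (P N)"
    and P: "\<And>N v. N \<ge> 1 \<Longrightarrow> P N (J v) = J (\<Sum>n=- int N..int N. inner (e n) v *\<^sub>R e n)"
    and M: "prob_space M"
    and q: "2 \<le> q" and a_q: "a q \<noteq> 0"
    and chi: "1/4 < chi" and \<nu>: "1/4 < \<nu>" "\<nu> < 3/4"
    and \<xi>: "\<xi> \<in> H chi"
    and W: "cylindrical_wiener M T (H (-\<nu>)) (ip (-\<nu>)) (\<lambda>n. J (e n)) W"
    and S_bdd: "\<And>N. N \<ge> 1 \<Longrightarrow> bounded_linear_between (H (-\<nu>)) (ip (-\<nu>)) (H (-\<nu>)) (ip (-\<nu>)) (S N)"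
    and S_smooth: "\<And>N r. N \<ge> 1 \<Longrightarrow> r \<ge> -\<nu> \<Longrightarrow> S N ` H r \<subseteq> H (r + 1)"
    and S_sup: "(SUP N\<in>{1..}. SUP s\<in>{0..1}. SUP w\<in>{w. norm w \<le> 1}.
                   ereal (real N powr (- s) * ip_norm (ip s) (S N (J w)))) < \<infinity>"
    and S_e0: "\<And>N. N \<ge> 1 \<Longrightarrow> S N (J (e 0)) = J (e 0)"
    and S_fpow: "\<And>N v. N \<ge> 1 \<Longrightarrow>
                   J (fpow e (\<lambda>v. \<eta> *\<^sub>R v - A v) (-\<nu>) (inv J (S N (J v)))) =
                   S N (J (fpow e (\<lambda>v. \<eta> *\<^sub>R v - A v) (-\<nu>) v))"
    and S_sym: "\<And>N u v. N \<ge> 1 \<Longrightarrow> inner (inv J (S N (J u))) v = inner u (inv J (S N (J v)))"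
    and S_P: "\<And>N v. N \<ge> 1 \<Longrightarrow> P N (S N (J v)) = S N (P N (J v))"
    and Y_meas: "\<And>N n. N \<ge> 1 \<Longrightarrow> n \<le> N \<Longrightarrow> Y N n \<in> borel_measurable M"
    and Y_0: "\<And>N \<omega>. N \<ge> 1 \<Longrightarrow> \<omega> \<in> space M \<Longrightarrow> J (Y N 0 \<omega>) = P N \<xi>"
    and Y_Suc: "\<And>N n \<omega>. N \<ge> 1 \<Longrightarrow> n < N \<Longrightarrow> \<omega> \<in> space M \<Longrightarrow>
                  J (Y N (Suc n) \<omega>) =
                  P N (S N (J (Y N n \<omega>)
                            + (T / real N) *\<^sub>R J (\<Sum>k\<le>q. a k *\<^sub>R L2_power (Y N n \<omega>) k)
                            + (W (real (n + 1) * T / real N) \<omega> - W (real n * T / real N) \<omega>)))"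
  shows "\<forall>p::real>0. liminf (\<lambda>N. \<integral>\<^sup>+ \<omega>. ennreal (norm (Y N N \<omega>) powr p) \<partial>M) = \<infinity>"
proof (intro allI impI)
  fix p :: real assume p: "0 < p"
  define L where "L = (\<lambda>v. \<eta> *\<^sub>R v - A v)"
  have e: "e = basis"
  proof
    fix n :: int
    consider "n = 0" | k where "n = int k" "k \<ge> 1" | k where "n = - int k" "k \<ge> 1"
      by (cases n rule: int_cases2) (metis less_one not_le of_nat_0 minus_zero)+
    then show "e n = basis n"
      by cases (auto simp: e_0 e_pos e_neg basis_def trig_def[abs_def])
  qed
  obtain C where C: "0 \<le> C" and SC: "\<And>N w. 1 \<le> N \<Longrightarrow> norm w \<le> 1 \<Longrightarrow> ip_norm (ip 0) (S N (J w)) \<le> C"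
    using uniform_bound_at_0[OF S_sup] by blast
  have gal: "smoothed_galerkin L J H ip (P N) (S N) N \<nu> C" if N: "1 \<le> N" for N
  proof
    show "interpolation_spaces basis L J H ip" using interp by (simp add: e L_def)
    show "0 < \<nu>" "\<nu> \<le> 1" using \<nu> by auto
    show "P N (J v) = J (proj N v)" for v using P[OF N] by (simp add: proj_def e)
    show "S N ` H (-\<nu>) \<subseteq> H (-\<nu> + 1)" using S_smooth[OF N, of "-\<nu>"] by simp
  qed (use N S_bdd SC S_e0 S_sym S_P in \<open>simp_all add: e\<close>)
  obtain x where \<xi>x: "\<xi> = J x"
    using \<xi> interp chi by (auto simp: interpolation_spaces_def)
  have J: "J u = J v \<longleftrightarrow> u = v" for u v
    using smoothed_galerkin.J_eq_iff[OF gal[of 1]] by simp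
  have Y0: "Y N 0 \<omega> = proj N x" if "1 \<le> N" "\<omega> \<in> space M" for N \<omega>
    using Y_0[OF that] P[OF that(1), of x] by (simp add: \<xi>x J proj_def e)
  obtain \<beta> where bm: "\<And>m. std_brownian_motion M T (\<beta> m)"
    and indep: "prob_space.indep_vars M (\<lambda>_. PiM {0..T} (\<lambda>_. borel)) (\<lambda>n \<omega>. \<lambda>t\<in>{0..T}. \<beta> n t \<omega>) UNIV"
    and lim: "\<And>t. t \<in> {0..T} \<Longrightarrow> AE \<omega> in M.
       limitin (ip_topology (H (-\<nu>)) (ip (-\<nu>))) (\<lambda>F. \<Sum>n\<in>F. \<beta> n t \<omega> *\<^sub>R J (basis n)) (W t \<omega>)
         (finite_subsets_at_top UNIV)"
    using W unfolding cylindrical_wiener_def e by blast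
  obtain \<Lambda> \<Theta> \<epsilon> where \<Lambda>: "1 \<le> \<Lambda>" and \<Theta>: "1 \<le> \<Theta>" and \<epsilon>: "0 < \<epsilon>" "\<epsilon> \<le> 1"
    and blow: "\<And>N s Y w \<rho>. \<lbrakk>1 \<le> N; smoother N C s;
      Y 1 = s ((2 * \<Lambda> * real N + 1) *\<^sub>R basis 0 + w 0);
      \<And>n. n \<in> {1..<N} \<Longrightarrow>
        Y (Suc n) = s (Y n + (T / real N) *\<^sub>R proj N (nemytskii a q (Y n)) + w n);
      \<And>n. n < N \<Longrightarrow> proj N (w n) = w n; \<And>n. n < N \<Longrightarrow> norm (w n) \<le> \<rho>;
      \<rho> \<le> \<epsilon> / (real N * (\<Theta> * real N) ^ N)\<rbrakk> \<Longrightarrow> 2 ^ 2 ^ (N - 1) \<le> norm (Y N)"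
  proof (rule euler_blow_up[where a = a, OF T q a_q C], goal_cases)
    case (1 \<Lambda> \<Theta> \<epsilon>)
    show ?case by (rule 1(1)[OF 1(2-5)]) (rule 1(6))
  qed
  define b where "b = 2 * \<Lambda> + 1 + norm x + T * (\<Sum>k\<le>q. \<bar>a k\<bar> * (6 * norm x) ^ k)"
  define \<delta> where "\<delta> N = \<epsilon> / (3 * real N * real N * (\<Theta> * real N) ^ N)" for N
  have "0 \<le> T * (\<Sum>k\<le>q. \<bar>a k\<bar> * (6 * norm x) ^ k)"
    using T by (intro mult_nonneg_nonneg sum_nonneg) auto
  then have b: "0 \<le> b" using \<Lambda> norm_ge_zero[of x] unfolding b_def by linarith
  obtain D where D: "\<And>N. 1 \<le> N \<Longrightarrow> exp (- D * real N ^ (2 * q + 3)) \<le>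
    (2 * \<delta> N / sqrt (2 * pi * (T / real N)) * exp (- (b * real N ^ q + 1)\<^sup>2 / (2 * (T / real N)))) ^ (N * (2 * N + 1))"
    using tube_prob_lower_exp[OF T \<epsilon>(1) \<Theta> b, of q] q unfolding \<delta>_def by auto
  have lower: "ennreal (exp (- D * real N ^ (2 * q + 3)) * (2 ^ 2 ^ (N - 1)) powr p)
      \<le> (\<integral>\<^sup>+ \<omega>. ennreal (norm (Y N N \<omega>) powr p) \<partial>M)" if N: "1 \<le> N" for N
  proof -
    interpret prob_space M by (rule M)
    interpret smoothed_galerkin L J H ip "P N" "S N" N \<nu> C by (rule gal[OF N])
    have N1: "1 \<le> real N" using N by simp
    define \<tau> where "\<tau> n = real n * T / real N" for n
    \<comment> \<open>The first increment should equal \<open>u\<close>, all later ones should vanish.\<close>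
    define u where "u = (2 * \<Lambda> * real N + 1) *\<^sub>R basis 0 - proj N x - (T / real N) *\<^sub>R nemytskii a q (proj N x)"
    define t where "t m n = (if n = 0 then inner (basis m) u else 0)" for m :: int and n :: nat
    define E where "E = {\<omega> \<in> space M. \<forall>m\<in>{- int N..int N}. \<forall>n<N.
      \<bar>\<beta> m (real (n + 1) * T / real N) \<omega> - \<beta> m (real n * T / real N) \<omega> - t m n\<bar> \<le> \<delta> N}"
    have \<Theta>N: "1 \<le> (\<Theta> * real N) ^ N"
      using \<Theta> N1 mult_mono[of 1 \<Theta> 1 "real N"] by (intro one_le_power) simp
    have \<delta>0: "0 \<le> \<delta> N" using \<epsilon> \<Theta> by (simp add: \<delta>_def)
    have "1 \<le> 3 * real N * real N" using mult_mono[of 1 "3 * real N" 1 "real N"] N1 by simp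
    then have "1 \<le> 3 * real N * real N * (\<Theta> * real N) ^ N"
      using mult_mono[of 1 "3 * real N * real N" 1 "(\<Theta> * real N) ^ N"] \<Theta>N by simp
    then have \<delta>1: "\<delta> N \<le> 1"
      unfolding \<delta>_def using \<epsilon> by (subst divide_le_eq) auto
    have "norm u \<le> b * real N ^ q"
      unfolding u_def b_def using kick_target_le[OF T _ _ N order_refl refl, of q \<Lambda> x a] q \<Lambda> by simp
    then have t: "\<bar>t m n\<bar> + \<delta> N \<le> b * real N ^ q + 1" for m n
      using abs_inner_basis_le[of m u] \<delta>1 b by (auto simp: t_def)
    note tube = brownian_tube_prob_ge[where \<beta> = \<beta> and I = "{- int N..int N}" and t = t and \<delta> = "\<delta> N"
        and B = "b * real N ^ q + 1", OF M T N bm indep _ _ \<delta>0 t, folded E_def]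
    have E: "E \<in> sets M" and pE: "exp (- D * real N ^ (2 * q + 3)) \<le> measure M E"
    proof -
      show "E \<in> sets M" using tube(1) by simp
      have "card {- int N..int N} = 2 * N + 1" by simp
      then show "exp (- D * real N ^ (2 * q + 3)) \<le> measure M E"
        using tube(2) D[OF N] by simp
    qed
    have \<tau>: "\<tau> n \<in> {0..T}" if "n \<le> N" for n
      using that T N by (auto simp: \<tau>_def divide_le_eq mult.commute)
    have "AE \<omega> in M. \<forall>n\<in>{..N}. limitin (ip_topology (H (-\<nu>)) (ip (-\<nu>)))
        (\<lambda>F. \<Sum>m\<in>F. \<beta> m (\<tau> n) \<omega> *\<^sub>R J (basis m)) (W (\<tau> n) \<omega>) (finite_subsets_at_top UNIV)"
      using lim \<tau> by (intro AE_finite_allI) auto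
    then have ae: "AE \<omega> in M. ennreal ((2 ^ 2 ^ (N - 1)) powr p) * indicator E \<omega> \<le> ennreal (norm (Y N N \<omega>) powr p)"
    proof (rule AE_mp, intro AE_I2 impI)
      fix \<omega> assume \<omega>: "\<omega> \<in> space M"
        and lim: "\<forall>n\<in>{..N}. limitin (ip_topology (H (-\<nu>)) (ip (-\<nu>)))
          (\<lambda>F. \<Sum>m\<in>F. \<beta> m (\<tau> n) \<omega> *\<^sub>R J (basis m)) (W (\<tau> n) \<omega>) (finite_subsets_at_top UNIV)"
      show "ennreal ((2 ^ 2 ^ (N - 1)) powr p) * indicator E \<omega> \<le> ennreal (norm (Y N N \<omega>) powr p)"
      proof (cases "\<omega> \<in> E")
        case True
        define inc where "inc m n = \<beta> m (\<tau> (Suc n)) \<omega> - \<beta> m (\<tau> n) \<omega>" for m n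
        define w where "w n = (\<Sum>m=- int N..int N. (inc m n - t m n) *\<^sub>R basis m)" for n
        have step: "Y N (Suc n) \<omega> = smooth (proj N (Y N n \<omega>) + (T / real N) *\<^sub>R proj N (nemytskii a q (Y N n \<omega>))
            + (\<Sum>m=- int N..int N. inc m n *\<^sub>R basis m))" if n: "n < N" for n
          unfolding inc_def
        proof (rule galerkin_step)
          show "J (Y N (Suc n) \<omega>) = P N (S N (J (Y N n \<omega>) + (T / real N) *\<^sub>R J (nemytskii a q (Y N n \<omega>))
              + (W (\<tau> (Suc n)) \<omega> - W (\<tau> n) \<omega>)))"
            using Y_Suc[OF N n \<omega>] by (simp add: nemytskii_def \<tau>_def)
        qed (use lim n in auto)
        have pY: "proj N (Y N n \<omega>) = Y N n \<omega>" if "1 \<le> n" "n \<le> N" for n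
        proof -
          obtain k where k: "n = Suc k" "k < N" using \<open>1 \<le> n\<close> \<open>n \<le> N\<close> by (cases n) auto
          show ?thesis
            unfolding k(1) step[OF k(2)] proj_smooth
            by (simp only: linear_add[OF linear_proj] linear_scale[OF linear_proj] proj_proj proj_sum_basis)
        qed
        have w_eq: "w n = (\<Sum>m=- int N..int N. inc m n *\<^sub>R basis m) - (\<Sum>m=- int N..int N. t m n *\<^sub>R basis m)" for n
          by (simp add: w_def scaleR_diff_left sum_subtractf)
        have "2 ^ 2 ^ (N - 1) \<le> norm (Y N N \<omega>)"
        proof (rule blow[OF N smoother_smooth, where Y = "\<lambda>n. Y N n \<omega>" and w = w and \<rho> = "3 * real N * \<delta> N"])
          have "(\<Sum>m=- int N..int N. t m 0 *\<^sub>R basis m) = proj N u" by (simp add: t_def proj_def)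
          also have "\<dots> = (2 * \<Lambda> * real N + 1) *\<^sub>R basis 0 - proj N x - (T / real N) *\<^sub>R proj N (nemytskii a q (proj N x))"
            by (simp add: u_def linear_diff[OF linear_proj] linear_scale[OF linear_proj] proj_proj proj_basis)
          finally have "w 0 = (\<Sum>m=- int N..int N. inc m 0 *\<^sub>R basis m)
              - ((2 * \<Lambda> * real N + 1) *\<^sub>R basis 0 - proj N x - (T / real N) *\<^sub>R proj N (nemytskii a q (proj N x)))"
            by (simp only: w_eq)
          then show "Y N 1 \<omega> = smooth ((2 * \<Lambda> * real N + 1) *\<^sub>R basis 0 + w 0)"
            using step[of 0] N Y0[OF N \<omega>] by (simp add: proj_proj algebra_simps)
          show "Y N (Suc n) \<omega> = smooth (Y N n \<omega> + (T / real N) *\<^sub>R proj N (nemytskii a q (Y N n \<omega>)) + w n)"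
            if "n \<in> {1..<N}" for n
            using step[of n] pY[of n] that by (simp add: w_eq t_def)
          show "proj N (w n) = w n" for n
            unfolding w_def by (rule proj_sum_basis)
          have "\<bar>inc m n - t m n\<bar> \<le> \<delta> N" if "m \<in> {- int N..int N}" "n < N" for m n
            using True that by (auto simp: E_def inc_def \<tau>_def)
          then show "norm (w n) \<le> 3 * real N * \<delta> N" if "n < N" for n
            unfolding w_def using N that by (intro norm_basis_sum_le) auto
          show "3 * real N * \<delta> N \<le> \<epsilon> / (real N * (\<Theta> * real N) ^ N)"
            using N1 by (simp add: \<delta>_def)
        qed
        then have "(2 ^ 2 ^ (N - 1)) powr p \<le> norm (Y N N \<omega>) powr p"
          using p by (intro powr_mono2) auto
        then show ?thesis using True by (simp add: ennreal_leI)
      qed simp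
    qed
    have "ennreal (exp (- D * real N ^ (2 * q + 3)) * (2 ^ 2 ^ (N - 1)) powr p)
        \<le> ennreal (measure M E * (2 ^ 2 ^ (N - 1)) powr p)"
      using pE by (intro ennreal_leI mult_right_mono) auto
    also have "\<dots> = ennreal ((2 ^ 2 ^ (N - 1)) powr p) * emeasure M E"
      by (simp add: emeasure_eq_measure ennreal_mult mult.commute)
    also have "\<dots> = (\<integral>\<^sup>+ \<omega>. ennreal ((2 ^ 2 ^ (N - 1)) powr p) * indicator E \<omega> \<partial>M)"
      using E by (simp add: nn_integral_cmult_indicator)
    also have "\<dots> \<le> (\<integral>\<^sup>+ \<omega>. ennreal (norm (Y N N \<omega>) powr p) \<partial>M)"
      by (rule nn_integral_mono_AE[OF ae])
    finally show ?thesis .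
  qed
  have "\<infinity> = liminf (\<lambda>N. ennreal (exp (- D * real N ^ (2 * q + 3)) * (2 ^ 2 ^ (N - 1)) powr p))"
    by (rule lim_imp_Liminf[symmetric, OF sequentially_bot double_exponential_beats_exponential[OF p]])
  also have "\<dots> \<le> liminf (\<lambda>N. \<integral>\<^sup>+ \<omega>. ennreal (norm (Y N N \<omega>) powr p) \<partial>M)"
    using lower by (intro Liminf_mono eventually_sequentiallyI[of 1]) auto
  finally show "liminf (\<lambda>N. \<integral>\<^sup>+ \<omega>. ennreal (norm (Y N N \<omega>) powr p) \<partial>M) = \<infinity>"
    by (simp add: top_unique)
qed

end
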